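(* Let $(R,\mathfrak m,\mathbb K=R/\mathfrak m)$ be a regular local ring with regular system of parameters $(x)=(x_1,\ldots,x_n)$, and let $\widehat R$ be its $\mathfrak m$-adic completion. Assume that the Newton polyhedron $\operatorname{NP}(f)$ (with respect to $(x)$) of $f\in R$ has a loose edge and at least three vertices. Then $f$ is not irreducible in $\widehat R$.
   Context: Multi-index notation: $x^A=x_1^{A_1}\cdots x_n^{A_n}$ for $A\in\mathbb Z_{\ge0}^n$. The ring $R$ need not be complete and may have mixed characteristic. Newton polyhedron. Every $f\in R\setminus\{0\}$ has a finite expansion $f=\sum_A\rho_A x^A$ with $\rho_A\in R^\times\cup\{0\}$. The Newton polyhedron $\operatorname{NP}(f)\subset\mathbb R^n_{\ge0}$ is the smallest closed convex subset containing $\{A\in\mathbb Z^n_{\ge0}\mid\rho_A\ne0\}+\mathbb R^n_{\ge0}$ (it does not depend on the chosen expansion). Faces. A linear form $L:\mathbb R^n\to\mathbb R$ is a map $L(v)=\lambda_1v_1+\cdots+\lambda_nv_n$ with fixed $\lambda\in\mathbb R^n_{\ge0}$; it is positive if all $\lambda_i>0$. A compact face of $\operatorname{NP}(f)$ is a set of all points of $\operatorname{NP}(f)$ at which some positive linear form $L$ attains its minimum on $\operatorname{NP}(f)$. A vertex (resp. edge) is a compact face of dimension $0$ (resp. $1$). A loose edge is a compact edge that is not contained in any compact face of dimension $\ge2$. *)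

theory Defs
  imports "HOL-Analysis.Analysis" "HOL-Algebra.Algebra" "HOL-Algebra.Ideal_Product" "HOL-Library.Extended_Nat"
begin

section \<open>Regular local rings\<close>

definition krull_dim :: "('a, 'b) ring_scheme \<Rightarrow> enat"
  where "krull_dim R =
    Sup {enat k | k. \<exists>P. (\<forall>j\<le>k. primeideal (P j) R) \<and> (\<forall>j<k. P j \<subset> P (Suc j))}"

locale noetherian_local_ring = cring R + noetherian_ring R for R (structure) +
  fixes \<mm> :: "'a set"
  assumes maximalideal: "maximalideal \<mm> R"
    and unique_maximalideal: "maximalideal I R \<Longrightarrow> I = \<mm>"

locale regular_local_ring = noetherian_local_ring +
  assumes generated_by_dim:
    "\<exists>A \<subseteq> carrier R. finite A \<and> Idl A = \<mm> \<and> enat (card A) = krull_dim R"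

text \<open>The index type of the regular system of parameters has cardinality \<open>n = dim R\<close>.\<close>

locale regular_system_of_parameters = regular_local_ring +
  fixes x :: "'n::finite \<Rightarrow> 'a"
  assumes params_closed: "range x \<subseteq> carrier R"
    and params_generate: "Idl (range x) = \<mm>"
    and params_card: "enat CARD('n) = krull_dim R"


section \<open>The adic completion\<close>

text \<open>
  The inverse limit over \<open>k\<close> of the rings \<open>R Quot I^k\<close>. The transition map
  \<open>R Quot I^(k+1) \<rightarrow> R Quot I^k\<close> sends a coset to the coset containing it, so a family of cosets
  is compatible iff it is decreasing. The powers of \<open>I\<close> are those of the monoid of ideals
  \<^term>\<open>ideals_set R\<close>, whose product is the product of ideals and whose unit is the whole ring.
\<close>

definition adic_completion :: "('a, 'b) ring_scheme \<Rightarrow> 'a set \<Rightarrow> (nat \<Rightarrow> 'a set) ring"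
  where "adic_completion R I =
    \<lparr>carrier = {s. (\<forall>k. s k \<in> carrier (R Quot (I [^]\<^bsub>ideals_set R\<^esub> k))) \<and> (\<forall>k. s (Suc k) \<subseteq> s k)},
     monoid.mult = (\<lambda>s t k. s k \<otimes>\<^bsub>R Quot (I [^]\<^bsub>ideals_set R\<^esub> k)\<^esub> t k),
     one = (\<lambda>k. \<one>\<^bsub>R Quot (I [^]\<^bsub>ideals_set R\<^esub> k)\<^esub>),
     ring.zero = (\<lambda>k. \<zero>\<^bsub>R Quot (I [^]\<^bsub>ideals_set R\<^esub> k)\<^esub>),
     add = (\<lambda>s t k. s k \<oplus>\<^bsub>R Quot (I [^]\<^bsub>ideals_set R\<^esub> k)\<^esub> t k)\<rparr>"

definition to_completion :: "('a, 'b) ring_scheme \<Rightarrow> 'a set \<Rightarrow> 'a \<Rightarrow> (nat \<Rightarrow> 'a set)"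
  where "to_completion R I a = (\<lambda>k. (I [^]\<^bsub>ideals_set R\<^esub> k) +>\<^bsub>R\<^esub> a)"


section \<open>Newton polyhedra\<close>

definition monomial :: "('a, 'b) ring_scheme \<Rightarrow> ('n::finite \<Rightarrow> 'a) \<Rightarrow> nat ^ 'n \<Rightarrow> 'a"
  where "monomial R x A = (\<Otimes>\<^bsub>R\<^esub>i\<in>UNIV. x i [^]\<^bsub>R\<^esub> (A $ i))"

definition is_expansion ::
    "('a, 'b) ring_scheme \<Rightarrow> ('n::finite \<Rightarrow> 'a) \<Rightarrow> 'a \<Rightarrow> (nat ^ 'n \<Rightarrow> 'a) \<Rightarrow> bool"
  where "is_expansion R x f \<rho> \<longleftrightarrow>
    (\<forall>A. \<rho> A \<in> Units R \<union> {\<zero>\<^bsub>R\<^esub>}) \<and>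
    finite {A. \<rho> A \<noteq> \<zero>\<^bsub>R\<^esub>} \<and>
    f = (\<Oplus>\<^bsub>R\<^esub>A\<in>{A. \<rho> A \<noteq> \<zero>\<^bsub>R\<^esub>}. \<rho> A \<otimes>\<^bsub>R\<^esub> monomial R x A)"

definition polyhedron_of_support :: "(nat ^ 'n) set \<Rightarrow> (real ^ 'n) set"
  where "polyhedron_of_support S =
    (\<lambda>C. closed C \<and> convex C) hull
      {(\<chi> i. real (A $ i)) + v | A v. A \<in> S \<and> (\<forall>i. 0 \<le> v $ i)}"

text \<open>
  Over a regular local ring every nonzero \<open>f\<close> has an expansion, and the polyhedron does not
  depend on which one is used, so the choice made here is immaterial.
\<close>

definition newton_polyhedron ::
    "('a, 'b) ring_scheme \<Rightarrow> ('n::finite \<Rightarrow> 'a) \<Rightarrow> 'a \<Rightarrow> (real ^ 'n) set"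
  where "newton_polyhedron R x f =
    polyhedron_of_support {A. (SOME \<rho>. is_expansion R x f \<rho>) A \<noteq> \<zero>\<^bsub>R\<^esub>}"

text \<open>
  Only minima of linear forms with strictly positive coefficients are compact faces, so this is
  more restrictive than \<^const>\<open>face_of\<close>.
\<close>

definition compact_face :: "(real ^ 'n) set \<Rightarrow> (real ^ 'n) set \<Rightarrow> bool"
  where "compact_face P F \<longleftrightarrow>
    (\<exists>l. (\<forall>i. 0 < l $ i) \<and> F = {v \<in> P. \<forall>w\<in>P. l \<bullet> v \<le> l \<bullet> w})"

definition np_vertex :: "(real ^ 'n) set \<Rightarrow> (real ^ 'n) set \<Rightarrow> bool"
  where "np_vertex P F \<longleftrightarrow> compact_face P F \<and> aff_dim F = 0"

definition np_edge :: "(real ^ 'n) set \<Rightarrow> (real ^ 'n) set \<Rightarrow> bool"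
  where "np_edge P F \<longleftrightarrow> compact_face P F \<and> aff_dim F = 1"

definition loose_edge :: "(real ^ 'n) set \<Rightarrow> (real ^ 'n) set \<Rightarrow> bool"
  where "loose_edge P E \<longleftrightarrow>
    np_edge P E \<and> (\<nexists>F. compact_face P F \<and> aff_dim F \<ge> 2 \<and> E \<subseteq> F)"

end

theory Submission
  imports Defs
begin

text \<open>
  Let \<open>[A, B]\<close> be the loose edge and \<open>C = min(A, B)\<close> coordinatewise. Looseness forces the whole support of
  \<open>f\<close> into the set of points above the line through \<open>A\<close> and \<open>B\<close>, since otherwise a linear form defining
  the edge could be tilted until it defines a compact face of dimension at least 2 containing the
  edge. If \<open>C = 0\<close>, then everything lies above the segment \<open>[A, B]\<close> and there are at most two vertices.
  Otherwise the edge part of \<open>f\<close> is \<open>x^C G\<close>, where \<open>x^C\<close> and \<open>G\<close> are nonunits and every monomial above the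
  line is a combination of \<open>x^C\<close> and \<open>G\<close> of the same weight. Hensel lifting along the weight
  then lifts \<open>x^C G\<close> to a factorization of \<open>f\<close> in the completion.
\<close>

section \<open>Ideals and monomials\<close>

text \<open>In general \<open>R\<close> has neither a grading nor a coefficient field, and the
  coefficients of an expansion are not unique, so weighted initial forms are not at hand. Ideals
  generated by monomials take their place: a property that cuts out an ideal has to be checked on
  single monomials only. The lifting runs along such ideals, generated by monomials that lie above a
  line and have large weight. The condition on the line is essential: a monomial of large weight
  that is not above it need not lie in the ideal generated by \<open>x^C\<close> and
  \<open>G\<close>. The factors are not formed as limits; they are compatible sequences in
  \<open>R\<close>, and a constant converts weights, which are real, into powers of
  \<open>\<mm>\<close>. Irreducibility here speaks of proper factors, so two nonunit factors do not
  suffice: it must also be excluded that \<open>f\<close> divides its own factor. That the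
  completion is a domain is not established, which is why this needs an argument of its own.\<close>

lemma (in cring) idealI_closed:
  assumes "S \<subseteq> carrier R" "\<zero> \<in> S"
    and "\<And>a b. a \<in> S \<Longrightarrow> b \<in> S \<Longrightarrow> a \<oplus> b \<in> S"
    and smult: "\<And>a r. a \<in> S \<Longrightarrow> r \<in> carrier R \<Longrightarrow> r \<otimes> a \<in> S"
  shows "ideal S R"
proof (rule idealI)
  show "subgroup S (add_monoid R)"
  proof (rule group.subgroupI[OF add.group_axioms])
    fix a assume a: "a \<in> S"
    then have "\<ominus> a = (\<ominus> \<one>) \<otimes> a" using assms(1) by (simp add: l_minus subsetD)
    then show "inv\<^bsub>add_monoid R\<^esub> a \<in> S" using smult[OF a, of "\<ominus> \<one>"]
      by (simp add: a_inv_def)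
  qed (use assms(1-3) in auto)
next
  fix a y assume "a \<in> S" "y \<in> carrier R"
  then show "y \<otimes> a \<in> S" "a \<otimes> y \<in> S" using smult[of a y] assms(1) m_comm[of a y] by auto
qed (rule ring_axioms)

lemma (in ring) ideal_a_closed: "ideal I R \<Longrightarrow> a \<in> I \<Longrightarrow> b \<in> I \<Longrightarrow> a \<oplus> b \<in> I"
  by (simp add: additive_subgroup.a_closed ideal.axioms(1))

lemma (in ring) ideal_minus_closed: "ideal I R \<Longrightarrow> a \<in> I \<Longrightarrow> b \<in> I \<Longrightarrow> a \<ominus> b \<in> I"
  by (simp add: a_minus_def additive_subgroup.a_closed additive_subgroup.a_inv_closed ideal.axioms(1))

lemma (in ring) ideal_zero_closed: "ideal I R \<Longrightarrow> \<zero> \<in> I"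
  by (simp add: additive_subgroup.zero_closed ideal.axioms(1))

lemma (in ring) ideal_minus_trans:
  assumes "ideal I R" "a \<ominus> b \<in> I" "b \<ominus> c \<in> I" "a \<in> carrier R" "b \<in> carrier R" "c \<in> carrier R"
  shows "a \<ominus> c \<in> I"
proof -
  have "a \<ominus> c = (a \<ominus> b) \<oplus> (b \<ominus> c)" using assms(4-6)
    by (simp add: a_minus_def a_assoc r_neg1)
  then show ?thesis using ideal_a_closed[OF assms(1-3)] by simp
qed

lemma (in cring) minus_add_minus:
  assumes "a \<in> carrier R" "b \<in> carrier R" "c \<in> carrier R" "d \<in> carrier R"
  shows "(a \<oplus> b) \<ominus> (c \<oplus> d) = (a \<ominus> c) \<oplus> (b \<ominus> d)"
  using assms by algebra

lemma (in cring) r_distr_minus: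
  assumes "r \<in> carrier R" "a \<in> carrier R" "b \<in> carrier R"
  shows "r \<otimes> a \<ominus> r \<otimes> b = r \<otimes> (a \<ominus> b)"
  using assms by algebra

lemma (in cring) ideal_finsum_closed:
  assumes "ideal I R" "\<And>i. i \<in> T \<Longrightarrow> g i \<in> I"
  shows "finsum R g T \<in> I"
  using assms(2)
proof (induction T rule: infinite_finite_induct)
  case (insert i T)
  then have "g \<in> T \<rightarrow> carrier R" "g i \<in> carrier R"
    using ideal.Icarr[OF assms(1)] by auto
  then show ?case using insert ideal_a_closed[OF assms(1)] by simp
qed (simp_all add: ideal_zero_closed[OF assms(1)])

text \<open>The colon ideal \<open>(K : Y)\<close>. With a one-element \<open>Y\<close> it lets one
  factor of a product vary while the other is fixed; for the powers of an element it gives the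
  ascending chain in Krull's theorem.\<close>

lemma (in cring) colon_ideal:
  assumes "ideal K R" "Y \<subseteq> carrier R"
  shows "ideal {a \<in> carrier R. \<forall>y\<in>Y. a \<otimes> y \<in> K} R"
proof (rule idealI_closed)
  fix a r assume "a \<in> {a \<in> carrier R. \<forall>y\<in>Y. a \<otimes> y \<in> K}" "r \<in> carrier R"
  then show "r \<otimes> a \<in> {a \<in> carrier R. \<forall>y\<in>Y. a \<otimes> y \<in> K}"
    using assms by (auto simp: m_assoc subset_eq intro: ideal.I_l_closed)
next
  fix a b assume "a \<in> {a \<in> carrier R. \<forall>y\<in>Y. a \<otimes> y \<in> K}" "b \<in> {a \<in> carrier R. \<forall>y\<in>Y. a \<otimes> y \<in> K}"
  then show "a \<oplus> b \<in> {a \<in> carrier R. \<forall>y\<in>Y. a \<otimes> y \<in> K}"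
    using assms(2) ideal_a_closed[OF assms(1)] by (simp add: l_distr subset_iff)
qed (use assms(2) ideal_zero_closed[OF assms(1)] in \<open>auto simp: subset_iff\<close>)

text \<open>In a Noetherian ring the union of a nonempty chain of ideals belongs to the chain, so
  Zorn's lemma applies to every nonempty family of ideals.\<close>

lemma (in noetherian_ring) exists_maximal_ideal:
  assumes "\<F> \<noteq> {}" "\<And>I. I \<in> \<F> \<Longrightarrow> ideal I R"
  shows "\<exists>M\<in>\<F>. \<forall>I\<in>\<F>. M \<subseteq> I \<longrightarrow> I = M"
proof (rule subset_Zorn_nonempty[OF assms(1)])
  fix C assume C: "C \<noteq> {}" "subset.chain \<F> C"
  then have sub: "C \<subseteq> \<F>" by (simp add: subset_chain_def)
  then have "subset.chain {I. ideal I R} C"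
    using C(2) assms(2) by (auto simp: subset_chain_def)
  then show "\<Union>C \<in> \<F>"
    using ideal_chain_is_trivial[OF C(1)] sub by auto
qed

section \<open>Units of a Noetherian local ring\<close>

context noetherian_local_ring
begin

lemma ideal_max: "ideal \<mm> R"
  using maximalideal by (rule maximalideal.axioms)

lemma max_closed: "a \<in> \<mm> \<Longrightarrow> a \<in> carrier R"
  by (rule ideal.Icarr[OF ideal_max])

lemma one_notin_max: "\<one> \<notin> \<mm>"
  using ideal.one_imp_carrier[OF ideal_max] maximalideal.I_notcarr[OF maximalideal] by auto

text \<open>A nonunit generates a proper ideal, which lies in some maximal ideal, and there is only
  one of these.\<close>

lemma unit_if_notin_max:
  assumes "a \<in> carrier R" "a \<notin> \<mm>"
  shows "a \<in> Units R"
proof (rule ccontr)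
  assume nu: "a \<notin> Units R"
  let ?F = "{I. ideal I R \<and> a \<in> I \<and> \<one> \<notin> I}"
  have "PIdl a \<in> ?F"
    using assms nu cgenideal_ideal cgenideal_self divides_one[of a] m_comm
    by (auto simp: cgenideal_def factor_def)
  then obtain M where M: "ideal M R" "a \<in> M" "\<one> \<notin> M" and max: "\<forall>I\<in>?F. M \<subseteq> I \<longrightarrow> I = M"
    using exists_maximal_ideal[of ?F] by blast
  have "maximalideal M R"
  proof (rule maximalidealI[OF M(1)])
    show "carrier R \<noteq> M" using M(3) by auto
    fix J assume "ideal J R" "M \<subseteq> J" "J \<subseteq> carrier R"
    then show "J = M \<or> J = carrier R"
      using max M ideal.one_imp_carrier[of J R] by blast
  qed
  then show False using unique_maximalideal assms(2) M(2) by blast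
qed

lemma max_iff_not_unit: "a \<in> carrier R \<Longrightarrow> a \<in> \<mm> \<longleftrightarrow> a \<notin> Units R"
proof
  assume "a \<in> \<mm>" then show "a \<notin> Units R"
    using ideal.I_l_closed[OF ideal_max, of a] one_notin_max unfolding Units_def by force
qed (use unit_if_notin_max in auto)

lemma max_add_unit: "a \<in> \<mm> \<Longrightarrow> u \<in> Units R \<Longrightarrow> u \<oplus> a \<in> Units R"
proof (rule ccontr)
  assume a: "a \<in> \<mm>" and u: "u \<in> Units R" and "u \<oplus> a \<notin> Units R"
  then have "u \<oplus> a \<in> \<mm>" using max_iff_not_unit[of "u \<oplus> a"] max_closed by auto
  then have "(u \<oplus> a) \<ominus> a \<in> \<mm>" using a ideal_minus_closed[OF ideal_max] by blast
  moreover have "(u \<oplus> a) \<ominus> a = u" using a u max_closed[OF a] Units_closed[OF u] by algebra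
  ultimately show False using max_iff_not_unit u by auto
qed

end

section \<open>Ideals generated by monomials\<close>

locale cring_with_sequence = cring R for R (structure) +
  fixes x :: "'n::finite \<Rightarrow> 'a"
  assumes seq_closed: "x i \<in> carrier R"
begin

lemma monomial_closed [simp, intro]: "monomial R x A \<in> carrier R"
  unfolding monomial_def using seq_closed by (intro finprod_closed) auto

lemma monomial_add: "monomial R x (A + B) = monomial R x A \<otimes> monomial R x B"
  unfolding monomial_def using seq_closed
  by (subst finprod_multf[symmetric]) (auto simp: nat_pow_mult)

lemma monomial_zero: "monomial R x 0 = \<one>"
  unfolding monomial_def by simp

lemma monomial_axis: "monomial R x (axis i k) = x i [^] k"
proof -
  have "monomial R x (axis i k) = (\<Otimes>j\<in>UNIV. if i = j then x j [^] k else \<one>)"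
    unfolding monomial_def using seq_closed by (intro finprod_cong) (auto simp: axis_def simp_implies_def)
  also have "\<dots> = x i [^] k"
    using seq_closed by (subst finprod_singleton) auto
  finally show ?thesis .
qed

definition mon_ideal :: "(nat ^ 'n) set \<Rightarrow> 'a set"
  where "mon_ideal S = Idl (monomial R x ` S)"

lemma mon_ideal_ideal: "ideal (mon_ideal S) R"
  unfolding mon_ideal_def by (intro genideal_ideal) auto

lemma mon_ideal_carr: "a \<in> mon_ideal S \<Longrightarrow> a \<in> carrier R"
  by (rule ideal.Icarr[OF mon_ideal_ideal])

lemma monomial_in_mon_ideal: "A \<in> S \<Longrightarrow> monomial R x A \<in> mon_ideal S"
  unfolding mon_ideal_def using genideal_self[of "monomial R x ` S"] by auto

lemma mon_ideal_subset:
  assumes "ideal K R" "\<And>A. A \<in> S \<Longrightarrow> monomial R x A \<in> K"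
  shows "mon_ideal S \<subseteq> K"
  unfolding mon_ideal_def using assms by (intro genideal_minimal) auto

lemma mon_ideal_mono: "S \<subseteq> T \<Longrightarrow> mon_ideal S \<subseteq> mon_ideal T"
  by (intro mon_ideal_subset mon_ideal_ideal monomial_in_mon_ideal) auto

text \<open>Membership is tested on generators, one factor at a time: with the other factor fixed,
  the admissible elements form a colon ideal.\<close>

lemma mon_ideal_mult:
  assumes "a \<in> mon_ideal S" "b \<in> mon_ideal T" "\<And>A B. A \<in> S \<Longrightarrow> B \<in> T \<Longrightarrow> A + B \<in> U"
  shows "a \<otimes> b \<in> mon_ideal U"
proof -
  have *: "monomial R x A \<otimes> b \<in> mon_ideal U" if "A \<in> S" for A
  proof -
    have "ideal {b \<in> carrier R. \<forall>y\<in>{monomial R x A}. b \<otimes> y \<in> mon_ideal U} R"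
      by (intro colon_ideal mon_ideal_ideal) auto
    moreover have "monomial R x B \<in> {b \<in> carrier R. \<forall>y\<in>{monomial R x A}. b \<otimes> y \<in> mon_ideal U}"
      if "B \<in> T" for B
      using monomial_in_mon_ideal[OF assms(3)[OF \<open>A \<in> S\<close> that]] monomial_add m_comm by auto
    ultimately have "mon_ideal T \<subseteq> {b \<in> carrier R. \<forall>y\<in>{monomial R x A}. b \<otimes> y \<in> mon_ideal U}"
      by (rule mon_ideal_subset)
    then show ?thesis using assms(2) m_comm[of b "monomial R x A"] mon_ideal_carr[OF assms(2)] by auto
  qed
  have "ideal {a \<in> carrier R. \<forall>y\<in>{b}. a \<otimes> y \<in> mon_ideal U} R"
    using mon_ideal_carr[OF assms(2)] by (intro colon_ideal mon_ideal_ideal) auto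
  then have "mon_ideal S \<subseteq> {a \<in> carrier R. \<forall>y\<in>{b}. a \<otimes> y \<in> mon_ideal U}"
    by (rule mon_ideal_subset) (use * in auto)
  then show ?thesis using assms(1) by auto
qed

lemma mon_ideal_axes: "mon_ideal (range (\<lambda>i. axis i 1)) = Idl (range x)"
proof -
  have "monomial R x ` range (\<lambda>i. axis i 1) = range x"
    unfolding image_image monomial_axis using seq_closed by simp
  then show ?thesis unfolding mon_ideal_def by simp
qed

text \<open>Because these elements form an ideal, all of a monomial ideal can be expanded over
  \<open>T\<close> once its generating monomials can. It is used with arbitrary coefficients modulo
  a monomial ideal, and with coefficients in \<open>\<mm>\<close> modulo zero.\<close>

lemma combinations_ideal:
  assumes "ideal J R" "ideal K R" "finite T"
  shows "ideal {e \<in> carrier R. \<exists>c. (\<forall>B\<in>T. c B \<in> J) \<and>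
    e \<ominus> (\<Oplus>B\<in>T. c B \<otimes> monomial R x B) \<in> K} R" (is "ideal ?S R")
proof (rule idealI_closed)
  note J = ideal.Icarr[OF assms(1)]
  show "\<zero> \<in> ?S"
    by (auto intro!: exI[of _ "\<lambda>_. \<zero>"] simp: ideal_zero_closed assms(1,2) a_minus_def)
  fix a assume a: "a \<in> ?S"
  then obtain c where c: "a \<in> carrier R" "\<And>B. B \<in> T \<Longrightarrow> c B \<in> J"
      "a \<ominus> (\<Oplus>B\<in>T. c B \<otimes> monomial R x B) \<in> K" by blast
  have cs: "(\<lambda>B. c B \<otimes> monomial R x B) \<in> T \<rightarrow> carrier R" using c J by auto
  {
    fix b assume "b \<in> ?S"
    then obtain c' where c': "b \<in> carrier R" "\<And>B. B \<in> T \<Longrightarrow> c' B \<in> J"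
        "b \<ominus> (\<Oplus>B\<in>T. c' B \<otimes> monomial R x B) \<in> K" by blast
    have cs': "(\<lambda>B. c' B \<otimes> monomial R x B) \<in> T \<rightarrow> carrier R" using c' J by auto
    have "(\<Oplus>B\<in>T. (c B \<oplus> c' B) \<otimes> monomial R x B) =
        (\<Oplus>B\<in>T. c B \<otimes> monomial R x B \<oplus> c' B \<otimes> monomial R x B)"
      using c(2) c'(2) J by (intro finsum_cong) (auto simp: l_distr simp_implies_def)
    also have "\<dots> = (\<Oplus>B\<in>T. c B \<otimes> monomial R x B) \<oplus> (\<Oplus>B\<in>T. c' B \<otimes> monomial R x B)"
      using cs cs' by (intro finsum_addf)
    finally have "a \<oplus> b \<ominus> (\<Oplus>B\<in>T. (c B \<oplus> c' B) \<otimes> monomial R x B) =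
       (a \<ominus> (\<Oplus>B\<in>T. c B \<otimes> monomial R x B)) \<oplus> (b \<ominus> (\<Oplus>B\<in>T. c' B \<otimes> monomial R x B))"
      using c(1) c'(1) finsum_closed[OF cs] finsum_closed[OF cs'] by (simp add: minus_add_minus)
    also have "\<dots> \<in> K" using c(3) c'(3) by (rule ideal_a_closed[OF assms(2)])
    finally show "a \<oplus> b \<in> ?S"
      using c c' ideal_a_closed[OF assms(1)] by (intro CollectI conjI exI[of _ "\<lambda>B. c B \<oplus> c' B"]) auto
  }
  fix r assume r: "r \<in> carrier R"
  have "(\<Oplus>B\<in>T. (r \<otimes> c B) \<otimes> monomial R x B) = (\<Oplus>B\<in>T. r \<otimes> (c B \<otimes> monomial R x B))"
    using c(2) J r by (intro finsum_cong) (auto simp: m_assoc simp_implies_def)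
  also have "\<dots> = r \<otimes> (\<Oplus>B\<in>T. c B \<otimes> monomial R x B)"
    using cs r by (simp add: finsum_rdistr assms(3))
  finally have "r \<otimes> a \<ominus> (\<Oplus>B\<in>T. (r \<otimes> c B) \<otimes> monomial R x B) =
      r \<otimes> (a \<ominus> (\<Oplus>B\<in>T. c B \<otimes> monomial R x B))"
    using c(1) r finsum_closed[OF cs] by (simp add: r_distr_minus)
  also have "\<dots> \<in> K" using c(3) r by (rule ideal.I_l_closed[OF assms(2)])
  finally show "r \<otimes> a \<in> ?S"
    using c r ideal.I_l_closed[OF assms(1)] by (intro CollectI conjI exI[of _ "\<lambda>B. r \<otimes> c B"]) auto
qed auto

end

section \<open>Dickson's lemma\<close>

lemma nat_incseq_subseq:
  fixes a :: "nat \<Rightarrow> nat"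
  shows "\<exists>\<phi>. strict_mono \<phi> \<and> incseq (\<lambda>k. a (\<phi> k))"
proof -
  obtain \<phi> where \<phi>: "strict_mono \<phi>" "monoseq (\<lambda>k. a (\<phi> k))"
    using seq_monosub[of a] by (auto simp: o_def)
  show ?thesis
  proof (cases "incseq (\<lambda>k. a (\<phi> k))")
    case False
    then have dec: "decseq (\<lambda>k. a (\<phi> k))" using \<phi>(2) by (simp add: monoseq_iff)
    \<comment> \<open>A decreasing sequence of naturals is constant from the place where its least
      value is attained.\<close>
    obtain N where N: "\<And>k. a (\<phi> N) \<le> a (\<phi> k)"
      using ex_has_least_nat[of "\<lambda>_. True" 0 "\<lambda>k. a (\<phi> k)"] by blast
    have "a (\<phi> (k + N)) = a (\<phi> N)" for k
      using N[of "k + N"] decseqD[OF dec, of N "k + N"] by simp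
    then have "incseq (\<lambda>k. a (\<phi> (k + N)))" by (simp add: incseq_def)
    then show ?thesis using \<phi>(1)
      by (intro exI[of _ "\<lambda>k. \<phi> (k + N)"]) (simp add: strict_mono_def)
  qed (use \<phi> in blast)
qed

text \<open>An infinite antichain contains an injective sequence. Thinning it out one coordinate at
  a time makes all coordinates weakly increasing, and then its first two terms are
  comparable.\<close>

lemma dickson_antichain_finite:
  fixes V :: "(nat ^ 'n::finite) set"
  assumes "\<And>A B. A \<in> V \<Longrightarrow> B \<in> V \<Longrightarrow> A \<le> B \<Longrightarrow> A = B"
  shows "finite V"
proof (rule ccontr)
  assume "infinite V"
  then obtain f :: "nat \<Rightarrow> nat ^ 'n" where f: "inj f" "range f \<subseteq> V"
    using infinite_countable_subset by blast
  have "\<exists>\<phi>. strict_mono \<phi> \<and> (\<forall>i\<in>I. incseq (\<lambda>k. f (\<phi> k) $ i))" if "finite I" for I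
    using that
  proof induction
    case empty
    then show ?case by (auto intro: exI[of _ id] simp: strict_mono_def)
  next
    case (insert i I)
    then obtain \<phi> where \<phi>: "strict_mono \<phi>" "\<And>i. i \<in> I \<Longrightarrow> incseq (\<lambda>k. f (\<phi> k) $ i)" by blast
    obtain \<psi> where \<psi>: "strict_mono \<psi>" "incseq (\<lambda>k. f (\<phi> (\<psi> k)) $ i)"
      using nat_incseq_subseq[of "\<lambda>k. f (\<phi> k) $ i"] by blast
    have "incseq (\<lambda>k. f (\<phi> (\<psi> k)) $ j)" if "j \<in> I" for j
      using \<phi>(2)[OF that] \<psi>(1) by (simp add: incseq_def strict_mono_less_eq)
    then show ?case using \<phi>(1) \<psi>
      by (intro exI[of _ "\<lambda>k. \<phi> (\<psi> k)"]) (auto simp: strict_mono_def)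
  qed
  from this[of UNIV] obtain \<phi> where \<phi>: "strict_mono \<phi>" "\<And>i. incseq (\<lambda>k. f (\<phi> k) $ i)" by auto
  then have "f (\<phi> 0) \<le> f (\<phi> 1)" by (simp add: less_eq_vec_def incseq_def)
  then have "f (\<phi> 0) = f (\<phi> 1)" using assms f(2) by blast
  then show False using f(1) \<phi>(1) by (auto dest!: injD simp: strict_mono_eq)
qed

section \<open>Existence of expansions\<close>

abbreviation total_degree :: "nat ^ 'n::finite \<Rightarrow> nat"
  where "total_degree A \<equiv> \<Sum>i\<in>UNIV. A $ i"

lemma finite_total_degree_le: "finite {A :: nat ^ 'n::finite. total_degree A \<le> N}"
proof (rule finite_subset)
  have "A $ i \<le> total_degree A" for A :: "nat ^ 'n" and i
    by (rule member_le_sum) auto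
  then show "{A :: nat ^ 'n. total_degree A \<le> N} \<subseteq> vec_lambda ` (UNIV \<rightarrow>\<^sub>E {..N})"
    by (auto intro!: image_eqI[of _ vec_lambda "vec_nth _"] intro: order_trans)
  show "finite (vec_lambda ` ((UNIV :: 'n set) \<rightarrow>\<^sub>E {..N}))"
    by (intro finite_imageI finite_PiE) auto
qed

lemma total_degree_less:
  fixes A B :: "nat ^ 'n::finite"
  assumes "A \<le> B" "A \<noteq> B"
  shows "total_degree A < total_degree B"
proof (rule sum_strict_mono_ex1)
  show "\<exists>i\<in>UNIV. A $ i < B $ i" using assms by (auto simp: less_eq_vec_def vec_eq_iff less_le)
qed (use assms in \<open>auto simp: less_eq_vec_def\<close>)

section \<open>Krull's intersection theorem for monomial ideals\<close>

locale local_ring_with_generators = noetherian_local_ring R \<mm> + cring_with_sequence R x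
  for R :: "('a, 'b) ring_scheme" (structure) and \<mm> and x :: "'n::finite \<Rightarrow> 'a" +
  assumes generate_max: "Idl (range x) = \<mm>"
begin

lemma max_eq_mon_ideal: "\<mm> = mon_ideal (range (\<lambda>i. axis i 1))"
  by (simp only: mon_ideal_axes generate_max)

lemma monomial_in_max: assumes "A \<noteq> 0" shows "monomial R x A \<in> \<mm>"
proof -
  obtain i where i: "A $ i \<noteq> 0" using assms by (auto simp: vec_eq_iff)
  then have "A = (A - axis i 1) + axis i 1" by (auto simp: vec_eq_iff axis_def)
  then have "monomial R x A = monomial R x (A - axis i 1) \<otimes> monomial R x (axis i 1)"
    by (metis monomial_add)
  moreover have "monomial R x (axis i 1) \<in> \<mm>"
    unfolding max_eq_mon_ideal by (rule monomial_in_mon_ideal) auto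
  ultimately show ?thesis using ideal.I_l_closed[OF ideal_max] by auto
qed

text \<open>\<open>K\<close> stands for an ideal maximal among those avoiding \<open>b\<close>, so
  \<open>b\<close> lies in every ideal strictly larger than \<open>K\<close>. Modulo
  \<open>K\<close> the element \<open>b\<close> is killed by \<open>\<mm>\<close>, and the
  stabilization of the annihilators of the powers of \<open>y\<close> makes \<open>y\<close>
  nilpotent.\<close>

lemma power_in_maximal_avoiding:
  assumes K: "ideal K R" and b: "b \<in> carrier R"
    and avoid: "\<And>z. z \<in> carrier R \<Longrightarrow> z \<notin> K \<Longrightarrow> \<exists>a\<in>K. \<exists>r\<in>carrier R. b = a \<oplus> r \<otimes> z"
    and bK: "b \<notin> K" and y: "y \<in> \<mm>"
  shows "\<exists>k::nat. y [^] k \<in> K"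
proof -
  have yc: "y \<in> carrier R" using y by (rule max_closed)
  note KC = ideal.Icarr[OF K]
  \<comment> \<open>As in Nakayama's lemma: otherwise \<open>b\<close> would be a multiple of
    \<open>y \<otimes> b\<close> modulo \<open>K\<close>, and the unit
    \<open>\<one> \<ominus> r \<otimes> y\<close> would force \<open>b\<close> into
    \<open>K\<close>.\<close>
  have yb: "y \<otimes> b \<in> K"
  proof (rule ccontr)
    assume "y \<otimes> b \<notin> K"
    then obtain a r where ar: "a \<in> K" "r \<in> carrier R" "b = a \<oplus> r \<otimes> (y \<otimes> b)"
      using avoid[of "y \<otimes> b"] b yc by auto
    have "(\<one> \<ominus> r \<otimes> y) \<otimes> b = b \<ominus> r \<otimes> (y \<otimes> b)" using ar(2) yc b by algebra
    also have "\<dots> = (a \<oplus> r \<otimes> (y \<otimes> b)) \<ominus> r \<otimes> (y \<otimes> b)" using ar(3) by simp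
    also have "\<dots> = a" using KC[OF ar(1)] ar(2) yc b by algebra
    finally have eq: "(\<one> \<ominus> r \<otimes> y) \<otimes> b = a" .
    have "\<one> \<oplus> \<ominus> (r \<otimes> y) \<in> Units R"
      using ideal.I_l_closed[OF ideal_max y ar(2)]
      by (intro max_add_unit) (auto intro: additive_subgroup.a_inv_closed ideal.axioms(1)[OF ideal_max])
    then have u: "\<one> \<ominus> r \<otimes> y \<in> Units R" by (simp add: a_minus_def)
    have "b = inv (\<one> \<ominus> r \<otimes> y) \<otimes> ((\<one> \<ominus> r \<otimes> y) \<otimes> b)"
      using u b Units_l_inv[OF u] by (simp add: m_assoc[symmetric] Units_closed)
    then show False using eq ideal.I_l_closed[OF K ar(1), of "inv (\<one> \<ominus> r \<otimes> y)"] u bK by auto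
  qed
  \<comment> \<open>These colon ideals ascend, so a maximal one yields an exponent \<open>k\<close>
    at which a further factor \<open>y\<close> has no effect.\<close>
  define C where "C k = {a \<in> carrier R. \<forall>z\<in>{y [^] k}. a \<otimes> z \<in> K}" for k :: nat
  have "\<exists>M\<in>range C. \<forall>I\<in>range C. M \<subseteq> I \<longrightarrow> I = M"
  proof (rule exists_maximal_ideal)
    fix I assume "I \<in> range C"
    then obtain k where "I = C k" by blast
    then show "ideal I R" using yc by (simp only: C_def) (rule colon_ideal[OF K], auto)
  qed simp
  then obtain k where k: "\<And>j. C k \<subseteq> C j \<Longrightarrow> C j = C k" by auto
  have "a \<otimes> y [^] Suc k \<in> K" if "a \<in> C k" for a
    using that ideal.I_r_closed[OF K, of "a \<otimes> y [^] k" y] yc by (auto simp: C_def m_assoc)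
  then have sub: "C k \<subseteq> C (Suc k)" by (auto simp: C_def)
  have "y [^] k \<in> K"
  proof (rule ccontr)
    assume "y [^] k \<notin> K"
    then obtain a r where ar: "a \<in> K" "r \<in> carrier R" "b = a \<oplus> r \<otimes> y [^] k"
      using avoid[of "y [^] k"] yc by auto
    have "r \<otimes> (y [^] k \<otimes> y) = y \<otimes> (a \<oplus> r \<otimes> y [^] k) \<ominus> y \<otimes> a"
      using KC[OF ar(1)] ar(2) yc nat_pow_closed[OF yc, of k] by algebra
    also have "\<dots> = y \<otimes> b \<ominus> y \<otimes> a" using ar(3) by simp
    also have "\<dots> \<in> K" using yb ideal.I_l_closed[OF K ar(1) yc] by (rule ideal_minus_closed[OF K])
    finally have "r \<in> C (Suc k)" using ar(2) by (simp add: C_def)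
    then have "r \<in> C k" using k[OF sub] by simp
    then have "r \<otimes> y [^] k \<in> K" by (simp add: C_def)
    then show False using ar(1,3) ideal_a_closed[OF K] bK by auto
  qed
  then show ?thesis by blast
qed

text \<open>Krull's intersection theorem: an ideal that is maximal among those containing the monomial
  ideal and avoiding \<open>b\<close> contains all monomials of high degree.\<close>

lemma krull_intersection:
  assumes b: "b \<in> carrier R" and deg: "\<And>N. b \<in> mon_ideal (S \<union> {A. N \<le> total_degree A})"
  shows "b \<in> mon_ideal S"
proof (rule ccontr)
  assume bS: "b \<notin> mon_ideal S"
  let ?F = "{I. ideal I R \<and> mon_ideal S \<subseteq> I \<and> b \<notin> I}"
  have "mon_ideal S \<in> ?F" using bS mon_ideal_ideal by auto
  then obtain K where K: "ideal K R" "mon_ideal S \<subseteq> K" "b \<notin> K"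
    and max: "\<And>I. ideal I R \<Longrightarrow> K \<subseteq> I \<Longrightarrow> b \<notin> I \<Longrightarrow> I = K"
    using exists_maximal_ideal[of ?F] by (smt (verit, best) emptyE mem_Collect_eq order_trans)
  note KC = ideal.Icarr[OF K(1)]
  \<comment> \<open>Otherwise \<open>K\<close> together with the multiples of \<open>z\<close> would
    be a larger ideal that still avoids \<open>b\<close>.\<close>
  have avoid: "\<exists>a\<in>K. \<exists>r\<in>carrier R. b = a \<oplus> r \<otimes> z" if z: "z \<in> carrier R" "z \<notin> K" for z
  proof (rule ccontr)
    assume neg: "\<not> ?thesis"
    let ?I = "{a \<oplus> r \<otimes> z |a r. a \<in> K \<and> r \<in> carrier R}"
    have "ideal ?I R"
    proof (rule idealI_closed)
      show "?I \<subseteq> carrier R" using KC z(1) by auto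
      show "\<zero> \<in> ?I" using z(1) by (auto intro!: exI[of _ \<zero>] simp: ideal_zero_closed[OF K(1)])
      fix u assume "u \<in> ?I"
      then obtain a r where u: "u = a \<oplus> r \<otimes> z" "a \<in> K" "r \<in> carrier R" by blast
      {
        fix v assume "v \<in> ?I"
        then obtain a' r' where v: "v = a' \<oplus> r' \<otimes> z" "a' \<in> K" "r' \<in> carrier R" by blast
        have "u \<oplus> v = (a \<oplus> a') \<oplus> (r \<oplus> r') \<otimes> z"
          using u(1,3) v(1,3) KC[OF u(2)] KC[OF v(2)] z(1) by algebra
        then show "u \<oplus> v \<in> ?I" using u v ideal_a_closed[OF K(1)] by blast
      }
      fix s assume s: "s \<in> carrier R"
      then have "s \<otimes> u = s \<otimes> a \<oplus> (s \<otimes> r) \<otimes> z"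
        using u(1,3) KC[OF u(2)] z(1) by algebra
      then show "s \<otimes> u \<in> ?I" using u s ideal.I_l_closed[OF K(1)] by blast
    qed
    moreover have "K \<subseteq> ?I"
    proof
      fix a assume "a \<in> K"
      moreover from this have "a = a \<oplus> \<zero> \<otimes> z" using KC z(1) by simp
      ultimately show "a \<in> ?I" by blast
    qed
    moreover have "z \<in> ?I"
    proof -
      have "z = \<zero> \<oplus> \<one> \<otimes> z" using z(1) by simp
      then show ?thesis using ideal_zero_closed[OF K(1)] by blast
    qed
    moreover have "b \<notin> ?I" using neg by blast
    ultimately show False using max[of ?I] z(2) by blast
  qed
  have "\<exists>k::nat. x i [^] k \<in> K" for i
    using power_in_maximal_avoiding[OF K(1) b avoid K(3), of "x i"] monomial_in_max[of "axis i 1"]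
      monomial_axis[of i 1] seq_closed by (auto simp: axis_eq_0_iff)
  then obtain k :: "'n \<Rightarrow> nat" where k: "\<And>i. x i [^] k i \<in> K" by metis
  \<comment> \<open>Pigeonhole: a degree above the sum of the \<open>k i\<close> forces some
    exponent to reach its \<open>k i\<close>.\<close>
  have "monomial R x A \<in> K" if A: "Suc (sum k UNIV) \<le> total_degree A" for A
  proof -
    have "\<exists>i. k i \<le> A $ i"
    proof (rule ccontr)
      assume "\<not> ?thesis"
      then have "total_degree A \<le> sum k UNIV" by (intro sum_mono) (auto simp: not_le less_imp_le)
      then show False using A by simp
    qed
    then obtain i where i: "k i \<le> A $ i" by blast
    then have "A = (A - axis i (k i)) + axis i (k i)" by (auto simp: vec_eq_iff axis_def)
    then have "monomial R x A = monomial R x (A - axis i (k i)) \<otimes> x i [^] k i"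
      by (metis monomial_add monomial_axis)
    then show ?thesis using k ideal.I_l_closed[OF K(1)] by auto
  qed
  then have "mon_ideal (S \<union> {A. Suc (sum k UNIV) \<le> total_degree A}) \<subseteq> K"
    using K(2) monomial_in_mon_ideal by (intro mon_ideal_subset K(1)) auto
  then show False using deg K(3) by blast
qed

section \<open>Partial expansions and their stabilization\<close>

definition strictly_above :: "(nat ^ 'n) set \<Rightarrow> (nat ^ 'n) set"
  where "strictly_above V = {B. \<exists>A\<in>V. A \<le> B \<and> A \<noteq> B}"

lemma max_times_monomial:
  assumes "c \<in> \<mm>" "\<And>i. A + axis i 1 \<in> S"
  shows "c \<otimes> monomial R x A \<in> mon_ideal S"
  using assms unfolding max_eq_mon_ideal
  by (intro mon_ideal_mult[of c _ "monomial R x A" "{A}"] monomial_in_mon_ideal)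
     (auto simp: add.commute)

lemma mon_ideal_Un_finite:
  assumes "e \<in> mon_ideal (S \<union> T)" "finite T"
  shows "\<exists>c. (\<forall>B\<in>T. c B \<in> carrier R) \<and> e \<ominus> (\<Oplus>B\<in>T. c B \<otimes> monomial R x B) \<in> mon_ideal S"
proof -
  let ?S = "{e \<in> carrier R. \<exists>c. (\<forall>B\<in>T. c B \<in> carrier R) \<and>
    e \<ominus> (\<Oplus>B\<in>T. c B \<otimes> monomial R x B) \<in> mon_ideal S}"
  have "mon_ideal (S \<union> T) \<subseteq> ?S"
  proof (rule mon_ideal_subset[OF combinations_ideal[OF oneideal mon_ideal_ideal assms(2)]])
    fix A assume "A \<in> S \<union> T"
    then consider "A \<in> S" | "A \<in> T" by blast
    then show "monomial R x A \<in> ?S"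
    proof cases
      case 1
      have "(\<Oplus>B\<in>T. \<zero> \<otimes> monomial R x B) = \<zero>" by simp
      then show ?thesis using monomial_in_mon_ideal[OF 1]
        by (auto intro!: exI[of _ "\<lambda>_. \<zero>"] simp: a_minus_def)
    next
      case 2
      have "(\<Oplus>B\<in>T. (if A = B then \<one> else \<zero>) \<otimes> monomial R x B) =
          (\<Oplus>B\<in>T. if A = B then monomial R x B else \<zero>)"
        by (intro finsum_cong) (auto simp: simp_implies_def)
      also have "\<dots> = monomial R x A"
        using 2 assms(2) by (subst add.finprod_singleton) auto
      finally show ?thesis using ideal_zero_closed[OF mon_ideal_ideal]
        by (auto intro!: exI[of _ "\<lambda>B. if A = B then \<one> else \<zero>"] simp: a_minus_def r_neg)
    qed
  qed
  then show ?thesis using assms(1) by blast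
qed

text \<open>Strictness makes the cofactor of \<open>x^A\<close> a nontrivial monomial, hence an
  element of \<open>\<mm>\<close>. Such a sum can later be absorbed into unit coefficients.\<close>

lemma mon_ideal_strictly_above:
  assumes "e \<in> mon_ideal (strictly_above V)" "finite V"
  shows "\<exists>c. (\<forall>A\<in>V. c A \<in> \<mm>) \<and> e = (\<Oplus>A\<in>V. c A \<otimes> monomial R x A)"
proof -
  let ?S = "{e \<in> carrier R. \<exists>c. (\<forall>A\<in>V. c A \<in> \<mm>) \<and>
    e \<ominus> (\<Oplus>A\<in>V. c A \<otimes> monomial R x A) \<in> {\<zero>}}"
  have "mon_ideal (strictly_above V) \<subseteq> ?S"
  proof (rule mon_ideal_subset[OF combinations_ideal[OF ideal_max zeroideal assms(2)]])
    fix B assume "B \<in> strictly_above V"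
    then obtain A where A: "A \<in> V" "A \<le> B" "A \<noteq> B" by (auto simp: strictly_above_def)
    have BA: "B - A \<noteq> 0" and eq: "B = (B - A) + A"
      using A by (auto simp: less_eq_vec_def vec_eq_iff less_le) (metis le_antisym)
    let ?c = "\<lambda>D. if A = D then monomial R x (B - A) else \<zero>"
    have "(\<Oplus>D\<in>V. ?c D \<otimes> monomial R x D) =
        (\<Oplus>D\<in>V. if A = D then monomial R x (B - A) \<otimes> monomial R x D else \<zero>)"
      by (intro finsum_cong) (auto simp: simp_implies_def)
    also have "\<dots> = monomial R x (B - A) \<otimes> monomial R x A"
      using A(1) assms(2) by (subst add.finprod_singleton) auto
    also have "\<dots> = monomial R x B" by (metis eq monomial_add)
    finally show "monomial R x B \<in> ?S" using monomial_in_max[OF BA]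
      by (auto intro!: exI[of _ ?c] simp: a_minus_def r_neg ideal_zero_closed[OF ideal_max])
  qed
  then obtain c where c: "\<forall>A\<in>V. c A \<in> \<mm>" "e \<ominus> (\<Oplus>A\<in>V. c A \<otimes> monomial R x A) = \<zero>" "e \<in> carrier R"
    using assms(1) by auto
  then have "(\<lambda>A. c A \<otimes> monomial R x A) \<in> V \<rightarrow> carrier R" using max_closed by auto
  then have "e = (\<Oplus>A\<in>V. c A \<otimes> monomial R x A)"
    using c(2,3) by simp
  then show ?thesis using c(1) by blast
qed

text \<open>An expansion up to degree \<open>N\<close>. The exponents form an antichain, which keeps
  them finite in number in the long run. Errors strictly above \<open>V\<close> are tolerated at
  every stage, since they only change the unit coefficients by elements of
  \<open>\<mm>\<close>.\<close>

definition partial_expansion :: "'a \<Rightarrow> nat \<Rightarrow> (nat ^ 'n) set \<Rightarrow> (nat ^ 'n \<Rightarrow> 'a) \<Rightarrow> bool"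
  where "partial_expansion f N V u \<longleftrightarrow>
    finite V \<and> (\<forall>A\<in>V. total_degree A < N \<and> u A \<in> Units R) \<and>
    (\<forall>A\<in>V. \<forall>B\<in>V. A \<le> B \<longrightarrow> A = B) \<and>
    f \<ominus> (\<Oplus>A\<in>V. u A \<otimes> monomial R x A) \<in> mon_ideal (strictly_above V \<union> {B. N \<le> total_degree B})"

lemma partial_expansion_step:
  assumes "partial_expansion f N V u" and f: "f \<in> carrier R"
  shows "\<exists>V' u'. partial_expansion f (Suc N) V' u' \<and> V \<subseteq> V' \<and> (\<forall>A\<in>V. u' A = u A)"
proof -
  define e where "e = f \<ominus> (\<Oplus>A\<in>V. u A \<otimes> monomial R x A)"
  have V: "finite V" "\<And>A. A \<in> V \<Longrightarrow> total_degree A < N" "\<And>A. A \<in> V \<Longrightarrow> u A \<in> Units R"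
    "\<And>A B. A \<in> V \<Longrightarrow> B \<in> V \<Longrightarrow> A \<le> B \<Longrightarrow> A = B"
    and e: "e \<in> mon_ideal (strictly_above V \<union> {B. N \<le> total_degree B})"
    using assms(1) by (auto simp: partial_expansion_def e_def)
  define T where "T = {B. total_degree B = N \<and> (\<forall>A\<in>V. \<not> A \<le> B)}"
  have fT: "finite T" by (rule finite_subset[OF _ finite_total_degree_le[of N]]) (auto simp: T_def)
  \<comment> \<open>A monomial of degree \<open>N\<close> that dominates a member of
    \<open>V\<close> is strictly above it, because members of \<open>V\<close> have smaller degree.
    So only the exponents in \<open>T\<close> can require new terms.\<close>
  have "strictly_above V \<union> {B. N \<le> total_degree B} \<subseteq>
      (strictly_above V \<union> {B. Suc N \<le> total_degree B}) \<union> T"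
    using V(2) by (fastforce simp: T_def strictly_above_def)
  then have "e \<in> mon_ideal ((strictly_above V \<union> {B. Suc N \<le> total_degree B}) \<union> T)"
    using e mon_ideal_mono by blast
  then obtain c where c: "\<And>B. B \<in> T \<Longrightarrow> c B \<in> carrier R"
      "e \<ominus> (\<Oplus>B\<in>T. c B \<otimes> monomial R x B) \<in> mon_ideal (strictly_above V \<union> {B. Suc N \<le> total_degree B})"
    using mon_ideal_Un_finite[OF _ fT] by blast
  \<comment> \<open>Unit coefficients give new terms. A coefficient in \<open>\<mm>\<close> turns
    its monomial into an error of degree at least \<open>N + 1\<close>.\<close>
  define T' where "T' = {B \<in> T. c B \<notin> \<mm>}"
  define V' where "V' = V \<union> T'"
  define u' where "u' A = (if A \<in> V then u A else c A)" for A
  let ?m = "\<lambda>c A. c A \<otimes> monomial R x A"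
  have disj: "V \<inter> T' = {}" by (auto simp: T_def T'_def)
  have fT': "finite T'" using fT by (auto simp: T'_def)
  have T'sub: "T' \<subseteq> T" by (auto simp: T'_def)
  have uc: "\<And>A. A \<in> V \<Longrightarrow> u A \<in> carrier R" using V(3) by auto
  define s where "s = (\<Oplus>A\<in>V. ?m u A)"
  define t' where "t' = (\<Oplus>A\<in>T'. ?m c A)"
  define t'' where "t'' = (\<Oplus>A\<in>T - T'. ?m c A)"
  have [simp]: "s \<in> carrier R" "t' \<in> carrier R" "t'' \<in> carrier R"
    unfolding s_def t'_def t''_def using uc c(1) T'sub by (auto intro!: finsum_closed)
  have "(\<Oplus>A\<in>V'. ?m u' A) = (\<Oplus>A\<in>V. ?m u' A) \<oplus> (\<Oplus>A\<in>T'. ?m u' A)"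
    unfolding V'_def using V(1) fT' disj uc c(1) T'sub
    by (intro finsum_Un_disjoint) (auto simp: u'_def)
  also have "(\<Oplus>A\<in>V. ?m u' A) = s"
    unfolding s_def using uc by (intro finsum_cong) (auto simp: u'_def simp_implies_def)
  also have "(\<Oplus>A\<in>T'. ?m u' A) = t'"
    unfolding t'_def using c(1) T'sub disj by (intro finsum_cong') (auto simp: u'_def)
  finally have sum': "(\<Oplus>A\<in>V'. ?m u' A) = s \<oplus> t'" .
  have "(\<Oplus>B\<in>T. ?m c B) = (\<Oplus>B\<in>T' \<union> (T - T'). ?m c B)"
    using T'sub by (simp add: Un_absorb1)
  also have "\<dots> = t' \<oplus> t''"
    unfolding t'_def t''_def using fT fT' c(1) T'sub by (intro finsum_Un_disjoint) auto
  finally have sumT: "(\<Oplus>B\<in>T. ?m c B) = t' \<oplus> t''" .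
  let ?K = "mon_ideal (strictly_above V' \<union> {B. Suc N \<le> total_degree B})"
  have "f \<ominus> (s \<oplus> t') = (e \<ominus> (t' \<oplus> t'')) \<oplus> t''"
    unfolding e_def s_def[symmetric] using f \<open>s \<in> _\<close> \<open>t' \<in> _\<close> \<open>t'' \<in> _\<close> by algebra
  moreover have "e \<ominus> (t' \<oplus> t'') \<in> ?K"
  proof -
    have "strictly_above V \<subseteq> strictly_above V'" by (auto simp: strictly_above_def V'_def)
    then have "mon_ideal (strictly_above V \<union> {B. Suc N \<le> total_degree B}) \<subseteq> ?K"
      by (intro mon_ideal_mono) auto
    then show ?thesis using c(2) unfolding sumT by blast
  qed
  moreover have "t'' \<in> ?K"
    unfolding t''_def
  proof (intro ideal_finsum_closed mon_ideal_ideal max_times_monomial)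
    fix A i assume A: "A \<in> T - T'"
    then show "c A \<in> \<mm>" by (auto simp: T'_def)
    have "total_degree (A + axis i 1) = total_degree A + total_degree (axis i 1)"
      by (simp add: sum.distrib)
    also have "total_degree (axis i 1) = 1" by (simp add: axis_def)
    finally show "A + axis i 1 \<in> strictly_above V' \<union> {B. Suc N \<le> total_degree B}"
      using A by (simp add: T_def)
  qed
  ultimately have "f \<ominus> (\<Oplus>A\<in>V'. ?m u' A) \<in> ?K"
    unfolding sum' using ideal_a_closed[OF mon_ideal_ideal] by auto
  moreover have "u' A \<in> Units R" "total_degree A < Suc N" if "A \<in> V'" for A
    using that V(2,3) c(1) unit_if_notin_max by (auto simp: V'_def u'_def T'_def T_def less_Suc_eq)
  moreover have "A = B" if "A \<in> V'" "B \<in> V'" "A \<le> B" for A B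
  proof (rule ccontr)
    assume "A \<noteq> B"
    then have "total_degree A < total_degree B" using that(3) by (rule total_degree_less[rotated])
    then show False using that V(2,4) \<open>A \<noteq> B\<close> by (fastforce simp: V'_def T'_def T_def)
  qed
  moreover have "finite V'" using V(1) fT' by (simp add: V'_def)
  ultimately have "partial_expansion f (Suc N) V' u'" by (auto simp: partial_expansion_def)
  then show ?thesis by (intro exI[of _ V'] exI[of _ u']) (auto simp: V'_def u'_def)
qed

text \<open>By Dickson's lemma the antichains of exponents of the partial expansions stabilize.\<close>

lemma exists_expansion:
  assumes f: "f \<in> carrier R"
  shows "\<exists>\<rho>. is_expansion R x f \<rho>"
proof -
  let ?P = "\<lambda>N (V, u). partial_expansion f N V u"
  let ?Q = "\<lambda>N (V, u) (V', u'). V \<subseteq> V' \<and> (\<forall>A\<in>V. u' A = u A)"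
  have "monomial R x 0 \<in> mon_ideal {B. 0 \<le> total_degree B}"
    by (rule monomial_in_mon_ideal) simp
  then have "f \<in> mon_ideal {B. 0 \<le> total_degree B}"
    using ideal.one_imp_carrier[OF mon_ideal_ideal] f by (simp add: monomial_zero)
  then have "partial_expansion f 0 {} (\<lambda>_. \<zero>)"
    using f by (simp add: partial_expansion_def a_minus_def strictly_above_def)
  then have 0: "?P 0 ({}, \<lambda>_. \<zero>)" by simp
  have "\<exists>Z. \<forall>N. ?P N (Z N) \<and> ?Q N (Z N) (Z (Suc N))"
  proof (rule dependent_nat_choice)
    show "\<exists>Z. ?P 0 Z" using 0 by blast
    fix Z N assume "?P N Z"
    then show "\<exists>Z'. ?P (Suc N) Z' \<and> ?Q N Z Z'"
      using partial_expansion_step[OF _ f, of N "fst Z" "snd Z"] by (auto simp: split_beta)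
  qed
  then obtain Z where Z': "\<forall>N. ?P N (Z N) \<and> ?Q N (Z N) (Z (Suc N))" ..
  note Z = Z'[rule_format, THEN conjunct1] Z'[rule_format, THEN conjunct2]
  define V where "V N = fst (Z N)" for N
  define u where "u N = snd (Z N)" for N
  have PE: "partial_expansion f N (V N) (u N)" for N using Z(1)[of N] by (simp add: V_def u_def split_beta)
  have step: "V N \<subseteq> V (Suc N)" "\<And>A. A \<in> V N \<Longrightarrow> u (Suc N) A = u N A" for N
    using Z(2)[of N] by (auto simp: V_def u_def split_beta)
  have mono: "V N \<subseteq> V M" if "N \<le> M" for N M using lift_Suc_mono_le[of V, OF step(1) that] .
  have pres: "u M A = u N A" if "N \<le> M" "A \<in> V N" for N M A
    using that
  proof (induction M rule: dec_induct)
    case (step M)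
    then have "A \<in> V M" using mono[of N M] by blast
    then show ?case using step Z(2)[of M] by (auto simp: V_def u_def split_beta)
  qed simp
  have anti: "A = B" if "A \<in> \<Union>(range V)" "B \<in> \<Union>(range V)" "A \<le> B" for A B
  proof -
    from that(1,2) obtain N M where "A \<in> V N" "B \<in> V M" by blast
    then have "A \<in> V (max N M)" "B \<in> V (max N M)"
      using mono[of N "max N M"] mono[of M "max N M"] by auto
    then show ?thesis using PE[of "max N M"] that(3) by (auto simp: partial_expansion_def)
  qed
  have "finite (\<Union>(range V))" using anti by (rule dickson_antichain_finite)
  then obtain N where N: "\<Union>(range V) \<subseteq> V N"
  proof -
    assume *: "\<And>N. \<Union>(range V) \<subseteq> V N \<Longrightarrow> thesis"
    have "\<exists>N. F \<subseteq> V N" if "finite F" "F \<subseteq> \<Union>(range V)" for F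
      using that
    proof (induction F)
      case (insert A F)
      then obtain N M where "F \<subseteq> V N" "A \<in> V M" by auto
      then have "insert A F \<subseteq> V (max N M)"
        using mono[of N "max N M"] mono[of M "max N M"] by auto
      then show ?case by blast
    qed auto
    then show thesis using * \<open>finite (\<Union>(range V))\<close> by blast
  qed
  have fV: "finite (V N)" and uV: "\<And>A. A \<in> V N \<Longrightarrow> u N A \<in> Units R"
    using PE[of N] by (auto simp: partial_expansion_def)
  define s where "s = (\<Oplus>A\<in>V N. u N A \<otimes> monomial R x A)"
  have us: "(\<lambda>A. u N A \<otimes> monomial R x A) \<in> V N \<rightarrow> carrier R" using uV by auto
  have sc: "s \<in> carrier R" unfolding s_def by (rule finsum_closed[OF us])
  \<comment> \<open>From stage \<open>N\<close> on the sum \<open>s\<close> no longer changes, so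
    its error satisfies the degree bound for every \<open>M\<close>, and Krull's theorem removes the
    high-degree part.\<close>
  have "f \<ominus> s \<in> mon_ideal (strictly_above (V N) \<union> {B. M \<le> total_degree B})" for M
  proof -
    have eq: "V (max N M) = V N" using N mono[of N "max N M"] by auto
    have "s = (\<Oplus>A\<in>V (max N M). u (max N M) A \<otimes> monomial R x A)"
      unfolding s_def eq using pres[of N "max N M"] us
      by (intro finsum_cong) (auto simp: simp_implies_def)
    then have "f \<ominus> s \<in> mon_ideal (strictly_above (V N) \<union> {B. max N M \<le> total_degree B})"
      using PE[of "max N M"] by (simp add: partial_expansion_def eq)
    moreover have "mon_ideal (strictly_above (V N) \<union> {B. max N M \<le> total_degree B}) \<subseteq>
        mon_ideal (strictly_above (V N) \<union> {B. M \<le> total_degree B})"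
      by (intro mon_ideal_mono) auto
    ultimately show ?thesis by blast
  qed
  then have "f \<ominus> s \<in> mon_ideal (strictly_above (V N))"
    by (rule krull_intersection[OF minus_closed[OF f sc]])
  then obtain c where c: "\<And>A. A \<in> V N \<Longrightarrow> c A \<in> \<mm>" "f \<ominus> s = (\<Oplus>A\<in>V N. c A \<otimes> monomial R x A)"
    using mon_ideal_strictly_above[OF _ fV] by blast
  have cs: "(\<lambda>A. c A \<otimes> monomial R x A) \<in> V N \<rightarrow> carrier R" using c(1) max_closed by auto
  \<comment> \<open>A unit plus an element of \<open>\<mm>\<close> is a unit, so the remaining error
    disappears into the coefficients and the finite expansion is exact.\<close>
  define \<rho> where "\<rho> A = (if A \<in> V N then u N A \<oplus> c A else \<zero>)" for A
  have \<rho>: "\<rho> A \<in> Units R" if "A \<in> V N" for A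
    using that max_add_unit[OF c(1) uV] by (simp add: \<rho>_def)
  have nz: "\<zero> \<notin> Units R" using max_iff_not_unit[of \<zero>] ideal_zero_closed[OF ideal_max] by auto
  have "\<rho> A \<noteq> \<zero> \<longleftrightarrow> A \<in> V N" for A
    using \<rho>[of A] nz by (cases "A \<in> V N") (auto simp: \<rho>_def)
  then have supp: "{A. \<rho> A \<noteq> \<zero>} = V N" by blast
  have "(\<Oplus>A\<in>V N. \<rho> A \<otimes> monomial R x A) =
      (\<Oplus>A\<in>V N. u N A \<otimes> monomial R x A \<oplus> c A \<otimes> monomial R x A)"
    using Units_closed[OF uV] max_closed[OF c(1)] by (intro finsum_cong') (auto simp: \<rho>_def l_distr)
  also have "\<dots> = s \<oplus> (f \<ominus> s)" unfolding s_def c(2)[unfolded s_def] using us cs by (rule finsum_addf)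
  also have "\<dots> = f" using f sc by algebra
  finally have "is_expansion R x f \<rho>"
    unfolding is_expansion_def supp using fV \<rho> \<open>_ = f\<close> by (auto simp: \<rho>_def)
  then show ?thesis by blast
qed

end

section \<open>Factorizations in the completion\<close>

definition ideal_power :: "('a, 'b) ring_scheme \<Rightarrow> 'a set \<Rightarrow> nat \<Rightarrow> 'a set"
  where "ideal_power R I k = I [^]\<^bsub>ideals_set R\<^esub> k"

lemma ideal_power_0: "ideal_power R I 0 = carrier R"
  by (simp add: ideal_power_def nat_pow_def ideals_set_def)

lemma ideal_power_Suc: "ideal_power R I (Suc k) = ideal_power R I k \<cdot>\<^bsub>R\<^esub> I"
  by (simp add: ideal_power_def nat_pow_def ideals_set_def)

context cring
begin

lemma ideal_power_ideal: "ideal I R \<Longrightarrow> ideal (ideal_power R I k) R"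
  by (induction k) (simp_all add: ideal_power_0 ideal_power_Suc oneideal ideal_prod_is_ideal)

lemma ideal_power_1: "ideal I R \<Longrightarrow> ideal_power R I (Suc 0) = I"
  using ideal_prod_commute[OF oneideal, of I] ideal_prod_one[of I]
  by (simp add: ideal_power_0 ideal_power_Suc)

lemma ideal_power_antimono:
  assumes "ideal I R" "j \<le> k"
  shows "ideal_power R I k \<subseteq> ideal_power R I j"
  using assms(2)
proof (induction k rule: dec_induct)
  case (step k)
  then show ?case
    using ideal_prod_inter[OF ideal_power_ideal[OF assms(1)] assms(1)] unfolding ideal_power_Suc by blast
qed simp

lemma adic_coset_mult:
  assumes "ideal I R" "a \<in> carrier R" "b \<in> carrier R"
  shows "(ideal_power R I k +> a) \<otimes>\<^bsub>R Quot (ideal_power R I k)\<^esub> (ideal_power R I k +> b) =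
    ideal_power R I k +> (a \<otimes> b)"
  using ideal.rcoset_mult_add[OF ideal_power_ideal[OF assms(1)] assms(2,3)] by (simp add: FactRing_def)

lemma adic_completion_carrier_coset:
  assumes "s \<in> carrier (adic_completion R I)"
  shows "\<exists>a\<in>carrier R. s k = ideal_power R I k +> a"
  using assms by (auto simp: adic_completion_def ideal_power_def[symmetric] FactRing_def A_RCOSETS_def')

text \<open>Inclusion of successive cosets amounts to congruence of the representatives modulo the
  coarser of the two powers.\<close>

lemma compatible_in_adic_completion:
  assumes I: "ideal I R" and g: "\<And>k. g k \<in> carrier R"
    and comp: "\<And>k. g (Suc k) \<ominus> g k \<in> ideal_power R I k"
  shows "(\<lambda>k. ideal_power R I k +> g k) \<in> carrier (adic_completion R I)"
proof -
  have "ideal_power R I (Suc k) +> g (Suc k) \<subseteq> ideal_power R I k +> g k" for k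
  proof -
    have "ideal_power R I (Suc k) +> g (Suc k) \<subseteq> ideal_power R I k +> g (Suc k)"
      using ideal_power_antimono[OF I, of k "Suc k"] by (auto simp: a_r_coset_def')
    also have "\<dots> = ideal_power R I k +> g k"
      using quotient_eq_iff_same_a_r_cos[OF ideal_power_ideal[OF I] g g] comp by blast
    finally show ?thesis .
  qed
  then show ?thesis
    using g by (auto simp: adic_completion_def ideal_power_def[symmetric] FactRing_def A_RCOSETS_def')
qed

text \<open>If \<open>f\<close> divided the factor \<open>g\<close>, then \<open>g = g w\<close> for some \<open>w\<close> in the extension of \<open>I\<close>, which forces \<open>g = 0\<close>.\<close>

lemma not_ring_irreducible_completion:
  assumes I: "ideal I R" and one: "\<one> \<notin> I" and f: "f \<in> carrier R"
    and g: "\<And>k. g k \<in> carrier R" and h: "\<And>k. h k \<in> carrier R"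
    and gcomp: "\<And>k. g (Suc k) \<ominus> g k \<in> ideal_power R I k"
    and hcomp: "\<And>k. h (Suc k) \<ominus> h k \<in> ideal_power R I k"
    and fgh: "\<And>k. f \<ominus> g k \<otimes> h k \<in> ideal_power R I k"
    and g1: "g 1 \<in> I" and h1: "h 1 \<in> I"
  shows "\<not> ring_irreducible\<^bsub>adic_completion R I\<^esub> (to_completion R I f)"
proof
  let ?P = "ideal_power R I" and ?S = "adic_completion R I"
  let ?f = "to_completion R I f" and ?g = "\<lambda>k. ?P k +> g k" and ?h = "\<lambda>k. ?P k +> h k"
  note P = ideal_power_ideal[OF I]
  note cos = quotient_eq_iff_same_a_r_cos[OF P]
  assume irr: "ring_irreducible\<^bsub>?S\<^esub> ?f"
  have gS: "?g \<in> carrier ?S" and hS: "?h \<in> carrier ?S"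
    using compatible_in_adic_completion[OF I] g h gcomp hcomp by auto
  have "?f = ?g \<otimes>\<^bsub>?S\<^esub> ?h"
    using cos[OF f, of "g _ \<otimes> h _"] fgh g h
    by (auto simp: to_completion_def adic_completion_def ideal_power_def[symmetric] adic_coset_mult[OF I g h])
  then have div: "?g divides\<^bsub>?S\<^esub> ?f" using hS by (auto simp: factor_def)
  have mult: "(s \<otimes>\<^bsub>?S\<^esub> t) k = s k \<otimes>\<^bsub>R Quot (?P k)\<^esub> t k" for s t k
    by (simp add: adic_completion_def ideal_power_def)
  \<comment> \<open>The quotient at index 0 is the zero ring, so index \<open>Suc 0\<close> is the
    first that separates \<open>\<one>\<close> from the elements of \<open>I\<close>.\<close>
  have nu: "?g \<notin> Units ?S"
  proof
    assume "?g \<in> Units ?S"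
    then obtain u where u: "u \<in> carrier ?S" "?g \<otimes>\<^bsub>?S\<^esub> u = \<one>\<^bsub>?S\<^esub>" unfolding Units_def by blast
    obtain c where c: "c \<in> carrier R" "u (Suc 0) = ?P (Suc 0) +> c"
      using adic_completion_carrier_coset[OF u(1)] by blast
    have "?P (Suc 0) +> (g (Suc 0) \<otimes> c) = (?g \<otimes>\<^bsub>?S\<^esub> u) (Suc 0)"
      by (simp only: mult c(2) adic_coset_mult[OF I g c(1)])
    also have "\<dots> = \<one>\<^bsub>?S\<^esub> (Suc 0)" by (simp only: u(2))
    also have "\<dots> = ?P (Suc 0) +> \<one>"
      by (simp add: adic_completion_def ideal_power_def[symmetric] FactRing_def)
    finally have "g (Suc 0) \<otimes> c \<ominus> \<one> \<in> I"
      using cos[of "g (Suc 0) \<otimes> c" \<one> "Suc 0"] g c(1) ideal_power_1[OF I] by simp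
    moreover have "g (Suc 0) \<otimes> c \<in> I" using ideal.I_r_closed[OF I _ c(1)] g1 by simp
    ultimately have "g (Suc 0) \<otimes> c \<ominus> (g (Suc 0) \<otimes> c \<ominus> \<one>) \<in> I"
      using ideal_minus_closed[OF I] by blast
    moreover have "g (Suc 0) \<otimes> c \<ominus> (g (Suc 0) \<otimes> c \<ominus> \<one>) = \<one>" using g[of "Suc 0"] c(1) by algebra
    ultimately show False using one by simp
  qed
  \<comment> \<open>A proper factor of an irreducible element is a unit. The nonunit
    \<open>?g\<close> is a factor, so it cannot be a proper one.\<close>
  have "?f divides\<^bsub>?S\<^esub> ?g"
    using irr div nu gS unfolding ring_irreducible_def irreducible_def properfactor_def by blast
  then obtain u where u: "u \<in> carrier ?S" "?g = ?f \<otimes>\<^bsub>?S\<^esub> u" by (auto simp: factor_def)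
  have "f \<in> ?P k" for k
  proof (cases k)
    case 0
    then show ?thesis using f by (simp add: ideal_power_0)
  next
    case (Suc k')
    obtain c where c: "c \<in> carrier R" "u k = ?P k +> c"
      using adic_completion_carrier_coset[OF u(1)] by blast
    have "?P k +> g k = ?P k +> (f \<otimes> c)"
      using fun_cong[OF u(2), of k] by (simp add: mult c(2) to_completion_def ideal_power_def[symmetric] adic_coset_mult[OF I f c(1)])
    then have 1: "g k \<ominus> f \<otimes> c \<in> ?P k" using cos[OF g] f c(1) by simp
    have "(f \<ominus> g k \<otimes> h k) \<otimes> c \<in> ?P k" using ideal.I_r_closed[OF P fgh c(1)] .
    then have "(g k \<ominus> f \<otimes> c) \<oplus> (f \<ominus> g k \<otimes> h k) \<otimes> c \<in> ?P k" using 1 ideal_a_closed[OF P] by blast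
    moreover have "(g k \<ominus> f \<otimes> c) \<oplus> (f \<ominus> g k \<otimes> h k) \<otimes> c = g k \<ominus> g k \<otimes> (h k \<otimes> c)"
      using g[of k] h[of k] f c(1) by algebra
    ultimately have 2: "g k \<ominus> g k \<otimes> (h k \<otimes> c) \<in> ?P k" by simp
    \<comment> \<open>From index 1 on all terms agree modulo \<open>I\<close>.\<close>
    have "h (Suc j) \<in> I" for j
    proof (induction j)
      case (Suc j)
      have "h (Suc (Suc j)) \<ominus> h (Suc j) \<in> I"
        using hcomp[of "Suc j"] ideal_power_antimono[OF I, of "Suc 0" "Suc j"] ideal_power_1[OF I] by auto
      then have "(h (Suc (Suc j)) \<ominus> h (Suc j)) \<oplus> h (Suc j) \<in> I" using Suc ideal_a_closed[OF I] by blast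
      moreover have "(h (Suc (Suc j)) \<ominus> h (Suc j)) \<oplus> h (Suc j) = h (Suc (Suc j))"
        using h[of "Suc j"] h[of "Suc (Suc j)"] by algebra
      ultimately show ?case by simp
    qed (use h1 in simp)
    then have hc: "h k \<otimes> c \<in> I" using ideal.I_r_closed[OF I _ c(1)] Suc by simp
    \<comment> \<open>Each use of the congruence between \<open>g k\<close> and
      \<open>g k \<otimes> (h k \<otimes> c)\<close> gains one factor from \<open>I\<close>, up to
      the precision \<open>k\<close> of that congruence.\<close>
    have "g k \<in> ?P j" if "j \<le> k" for j
      using that
    proof (induction j)
      case (Suc j)
      then have "g k \<otimes> (h k \<otimes> c) \<in> ?P (Suc j)"
        unfolding ideal_power_Suc using hc by (intro ideal_prod.prod) auto
      moreover have "g k \<ominus> g k \<otimes> (h k \<otimes> c) \<in> ?P (Suc j)"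
        using 2 ideal_power_antimono[OF I Suc.prems] by blast
      ultimately have "(g k \<ominus> g k \<otimes> (h k \<otimes> c)) \<oplus> g k \<otimes> (h k \<otimes> c) \<in> ?P (Suc j)"
        using ideal_a_closed[OF P] by blast
      moreover have "(g k \<ominus> g k \<otimes> (h k \<otimes> c)) \<oplus> g k \<otimes> (h k \<otimes> c) = g k"
        using g[of k] h[of k] c(1) by algebra
      ultimately show ?case by simp
    qed (use g in \<open>simp add: ideal_power_0\<close>)
    then have "g k \<otimes> h k \<in> ?P k" using ideal.I_r_closed[OF P _ h] by blast
    then have "(f \<ominus> g k \<otimes> h k) \<oplus> g k \<otimes> h k \<in> ?P k" using fgh ideal_a_closed[OF P] by blast
    moreover have "(f \<ominus> g k \<otimes> h k) \<oplus> g k \<otimes> h k = f" using g[of k] h[of k] f by algebra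
    ultimately show ?thesis by simp
  qed
  then have "?f = \<zero>\<^bsub>?S\<^esub>"
    by (auto simp: to_completion_def adic_completion_def ideal_power_def[symmetric] FactRing_def a_rcos_zero[OF P])
  then show False using irr by (simp add: ring_irreducible_def)
qed

end

context cring_with_sequence
begin

lemma mon_ideal_total_degree:
  assumes "I = Idl (range x)"
  shows "mon_ideal {A. N \<le> total_degree A} \<subseteq> ideal_power R I N"
proof -
  have I: "ideal I R" unfolding assms using seq_closed by (intro genideal_ideal) auto
  have "monomial R x A \<in> ideal_power R I N" if "N \<le> total_degree A" for A
    using that
  proof (induction N arbitrary: A)
    case (Suc N)
    then have "(\<Sum>i\<in>UNIV. A $ i) \<noteq> 0" by linarith
    then obtain i where i: "A $ i \<noteq> 0" by (meson sum.neutral)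
    then have A: "A = (A - axis i 1) + axis i 1" by (auto simp: vec_eq_iff axis_def)
    then have "(\<Sum>j\<in>UNIV. A $ j) = (\<Sum>j\<in>UNIV. (A - axis i 1) $ j) + (\<Sum>j\<in>UNIV. axis i 1 $ j)"
      by (metis (no_types, lifting) sum.cong sum.distrib vector_add_component)
    also have "(\<Sum>j\<in>UNIV. axis i (1::nat) $ j) = 1" by (simp add: axis_def)
    finally have "monomial R x (A - axis i 1) \<in> ideal_power R I N" using Suc by (intro Suc.IH) simp
    moreover have "monomial R x (axis i 1) \<in> I"
      unfolding assms mon_ideal_axes[symmetric] by (rule monomial_in_mon_ideal) simp
    ultimately have "monomial R x (A - axis i 1) \<otimes> monomial R x (axis i 1) \<in> ideal_power R I (Suc N)"
      unfolding ideal_power_Suc by (rule ideal_prod.prod)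
    then show ?case by (metis A monomial_add)
  qed (simp add: ideal_power_0)
  then show ?thesis by (intro mon_ideal_subset ideal_power_ideal[OF I]) auto
qed

end

section \<open>Lifting a factorization of the edge part\<close>

text \<open>The linearized equation is always solved with the initial factors \<open>g0\<close> and
  \<open>h0\<close>, never with the current ones. This does no harm: the current factors differ from
  them by elements of level 1, which moves every product in the new error one level further.\<close>

lemma (in cring) factorization_lifting:
  fixes F G H :: "nat \<Rightarrow> 'a set"
  assumes ideals: "\<And>n. ideal (F n) R" "\<And>n. ideal (G n) R" "\<And>n. ideal (H n) R"
    and mono: "\<And>m n. m \<le> n \<Longrightarrow> F n \<subseteq> F m" "\<And>m n. m \<le> n \<Longrightarrow> G n \<subseteq> G m" "\<And>m n. m \<le> n \<Longrightarrow> H n \<subseteq> H m"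
    and f: "f \<in> carrier R" and g0: "g0 \<in> carrier R" and h0: "h0 \<in> carrier R"
    and start: "f \<ominus> g0 \<otimes> h0 \<in> F 1"
    and decomp: "\<And>n a. a \<in> F n \<Longrightarrow> \<exists>q\<in>G n. \<exists>p\<in>H n. a = g0 \<otimes> p \<oplus> h0 \<otimes> q"
    and mult: "\<And>m n p q. q \<in> G m \<Longrightarrow> p \<in> H n \<Longrightarrow> q \<otimes> p \<in> F (m + n)"
  shows "\<exists>g h. \<forall>n. g n \<in> carrier R \<and> h n \<in> carrier R \<and>
    g n \<ominus> g0 \<in> G 1 \<and> h n \<ominus> h0 \<in> H 1 \<and> f \<ominus> g n \<otimes> h n \<in> F (Suc n) \<and>
    g (Suc n) \<ominus> g n \<in> G (Suc n) \<and> h (Suc n) \<ominus> h n \<in> H (Suc n)"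
proof -
  let ?P = "\<lambda>n Z. fst Z \<in> carrier R \<and> snd Z \<in> carrier R \<and>
    fst Z \<ominus> g0 \<in> G 1 \<and> snd Z \<ominus> h0 \<in> H 1 \<and> f \<ominus> fst Z \<otimes> snd Z \<in> F (Suc n)"
  let ?Q = "\<lambda>n Z Z'. fst Z' \<ominus> fst Z \<in> G (Suc n) \<and> snd Z' \<ominus> snd Z \<in> H (Suc n)"
  have "\<exists>Z. \<forall>n. ?P n (Z n) \<and> ?Q n (Z n) (Z (Suc n))"
  proof (rule dependent_nat_choice)
    have "?P 0 (g0, h0)" using g0 h0 start by (simp add: a_minus_def r_neg ideal_zero_closed ideals)
    then show "\<exists>Z. ?P 0 Z" by blast
    fix Z n assume Z: "?P n Z"
    obtain g h where gh: "Z = (g, h)" by (cases Z)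
    then have g: "g \<in> carrier R" "g \<ominus> g0 \<in> G 1" and h: "h \<in> carrier R" "h \<ominus> h0 \<in> H 1"
      and e: "f \<ominus> g \<otimes> h \<in> F (Suc n)" using Z by auto
    obtain q p where q: "q \<in> G (Suc n)" and p: "p \<in> H (Suc n)"
      and qp: "f \<ominus> g \<otimes> h = g0 \<otimes> p \<oplus> h0 \<otimes> q" using decomp[OF e] by blast
    have qc: "q \<in> carrier R" and pc: "p \<in> carrier R"
      using ideal.Icarr[OF ideals(2) q] ideal.Icarr[OF ideals(3) p] by auto
    have "f \<ominus> (g \<oplus> q) \<otimes> (h \<oplus> p) = (f \<ominus> g \<otimes> h) \<ominus> (g \<otimes> p \<oplus> h \<otimes> q \<oplus> q \<otimes> p)"
      using f g(1) h(1) qc pc by algebra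
    also have "\<dots> = (g0 \<otimes> p \<oplus> h0 \<otimes> q) \<ominus> (g \<otimes> p \<oplus> h \<otimes> q \<oplus> q \<otimes> p)" by (simp only: qp)
    \<comment> \<open>The linear terms cancel; what remains are products in which both factors have
      positive level.\<close>
    also have "\<dots> = \<zero> \<ominus> ((g \<ominus> g0) \<otimes> p \<oplus> q \<otimes> (h \<ominus> h0) \<oplus> q \<otimes> p)"
      using g0 h0 g(1) h(1) qc pc by algebra
    also have "\<dots> \<in> F (Suc (Suc n))"
    proof -
      have "(g \<ominus> g0) \<otimes> p \<in> F (Suc (Suc n))" using mult[OF g(2) p] by simp
      moreover have "q \<otimes> (h \<ominus> h0) \<in> F (Suc (Suc n))" using mult[OF q h(2)] by simp
      moreover have "q \<otimes> p \<in> F (Suc (Suc n))"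
        using mult[OF q p] mono(1)[of "Suc (Suc n)" "Suc n + Suc n"] by auto
      ultimately show ?thesis using ideals(1)[of "Suc (Suc n)"]
        by (intro ideal_minus_closed ideal_a_closed ideal_zero_closed)
    qed
    finally have 1: "f \<ominus> (g \<oplus> q) \<otimes> (h \<oplus> p) \<in> F (Suc (Suc n))" .
    have "q \<in> G 1" "p \<in> H 1" using q p mono(2,3)[of 1 "Suc n"] by auto
    then have "(g \<ominus> g0) \<oplus> q \<in> G 1" "(h \<ominus> h0) \<oplus> p \<in> H 1"
      using g(2) h(2) ideal_a_closed[OF ideals(2)] ideal_a_closed[OF ideals(3)] by blast+
    moreover have "(g \<ominus> g0) \<oplus> q = (g \<oplus> q) \<ominus> g0" using g(1) g0 qc by algebra
    moreover have "(h \<ominus> h0) \<oplus> p = (h \<oplus> p) \<ominus> h0" using h(1) h0 pc by algebra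
    moreover have "(g \<oplus> q) \<ominus> g = q" using g(1) qc by algebra
    moreover have "(h \<oplus> p) \<ominus> h = p" using h(1) pc by algebra
    ultimately have "?P (Suc n) (g \<oplus> q, h \<oplus> p) \<and> ?Q n Z (g \<oplus> q, h \<oplus> p)"
      using 1 q p g(1) h(1) qc pc by (simp add: gh)
    then show "\<exists>Z'. ?P (Suc n) Z' \<and> ?Q n Z Z'" by blast
  qed
  then obtain Z where "\<forall>n. ?P n (Z n) \<and> ?Q n (Z n) (Z (Suc n))" ..
  then show ?thesis by (intro exI[of _ "\<lambda>n. fst (Z n)"] exI[of _ "\<lambda>n. snd (Z n)"]) blast
qed

section \<open>Exponents above a line and division by the edge polynomial\<close>

abbreviation real_vec :: "nat ^ 'n::finite \<Rightarrow> real ^ 'n"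
  where "real_vec A \<equiv> (\<chi> i. real (A $ i))"

lemma real_vec_add: "real_vec (A + B) = real_vec A + real_vec B"
  by (simp add: vec_eq_iff)

text \<open>The index set of the weight filtration. The base point is a parameter because base
  points add under multiplication: \<open>C\<close> and \<open>A - C\<close> serve for the two
  factors, and \<open>A\<close> for their product.\<close>

definition above_line :: "real ^ 'n::finite \<Rightarrow> real ^ 'n \<Rightarrow> nat ^ 'n \<Rightarrow> real \<Rightarrow> (nat ^ 'n) set"
  where "above_line l d a t = {D. (\<exists>s. \<forall>i. real (a $ i) + s * d $ i \<le> real (D $ i)) \<and>
    l \<bullet> real_vec a + t \<le> l \<bullet> real_vec D}"

lemma above_line_antimono: "s \<le> t \<Longrightarrow> above_line l d a t \<subseteq> above_line l d a s"
  by (auto simp: above_line_def)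

lemma above_line_add:
  assumes "D \<in> above_line l d a t" "E \<in> above_line l d b s"
  shows "D + E \<in> above_line l d (a + b) (t + s)"
proof -
  obtain u v where "\<And>i. real (a $ i) + u * d $ i \<le> real (D $ i)" "\<And>i. real (b $ i) + v * d $ i \<le> real (E $ i)"
    using assms by (auto simp: above_line_def)
  then have "real ((a + b) $ i) + (u + v) * d $ i \<le> real ((D + E) $ i)" for i
    using add_mono[of "real (a $ i) + u * d $ i" "real (D $ i)" "real (b $ i) + v * d $ i" "real (E $ i)"]
    by (simp add: algebra_simps)
  moreover have "l \<bullet> real_vec (a + b) + (t + s) \<le> l \<bullet> real_vec (D + E)"
    unfolding real_vec_add inner_add_right using assms by (auto simp: above_line_def)
  ultimately show ?thesis unfolding above_line_def by blast
qed

text \<open>Its purpose is to reduce the decomposition of an ideal along \<open>g\<close> and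
  \<open>h\<close> to that of single monomials.\<close>

lemma (in cring) linear_combination_ideal:
  assumes "ideal P R" "ideal Q R" "g \<in> carrier R" "h \<in> carrier R"
  shows "ideal {a. \<exists>q\<in>Q. \<exists>p\<in>P. a = g \<otimes> p \<oplus> h \<otimes> q} R" (is "ideal ?K R")
proof (rule idealI_closed)
  note PC = ideal.Icarr[OF assms(1)] and QC = ideal.Icarr[OF assms(2)]
  show "?K \<subseteq> carrier R" using PC QC assms(3,4) by auto
  show "\<zero> \<in> ?K" using ideal_zero_closed[OF assms(1)] ideal_zero_closed[OF assms(2)] assms(3,4)
    by (auto intro!: bexI[of _ \<zero>])
  fix a assume "a \<in> ?K"
  then obtain p q where a: "p \<in> P" "q \<in> Q" "a = g \<otimes> p \<oplus> h \<otimes> q" by blast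
  {
    fix b assume "b \<in> ?K"
    then obtain p' q' where b: "p' \<in> P" "q' \<in> Q" "b = g \<otimes> p' \<oplus> h \<otimes> q'" by blast
    have "a \<oplus> b = g \<otimes> (p \<oplus> p') \<oplus> h \<otimes> (q \<oplus> q')"
      using a(3) b(3) PC[OF a(1)] PC[OF b(1)] QC[OF a(2)] QC[OF b(2)] assms(3,4) by algebra
    then show "a \<oplus> b \<in> ?K"
      using ideal_a_closed[OF assms(1) a(1) b(1)] ideal_a_closed[OF assms(2) a(2) b(2)] by blast
  }
  fix r assume r: "r \<in> carrier R"
  have "r \<otimes> a = g \<otimes> (r \<otimes> p) \<oplus> h \<otimes> (r \<otimes> q)"
    using a(3) r PC[OF a(1)] QC[OF a(2)] assms(3,4) by algebra
  then show "r \<otimes> a \<in> ?K"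
    using ideal.I_l_closed[OF assms(1) a(1) r] ideal.I_l_closed[OF assms(2) a(2) r] by blast
qed

context cring_with_sequence
begin

text \<open>Division by the edge polynomial \<open>G\<close>, using its term at the end point \<open>A\<close>: each step moves the
  exponent along the edge direction and raises the coordinates in which it fails to dominate \<open>C\<close>.\<close>

lemma edge_division:
  fixes A B :: "nat ^ 'n" and T \<rho> l t
  defines "C \<equiv> \<chi> i. min (A $ i) (B $ i)"
  defines "G \<equiv> \<Oplus>D\<in>T. \<rho> D \<otimes> monomial R x (D - C)"
  defines "W \<equiv> {D. (\<exists>s\<le>1. \<forall>i. real (A $ i) + s * (real (B $ i) - real (A $ i)) \<le> real (D $ i)) \<and>
    l \<bullet> real_vec A + t \<le> l \<bullet> real_vec D}"
  assumes T: "finite T" "A \<in> T" and \<rho>: "\<And>D. D \<in> T \<Longrightarrow> \<rho> D \<in> carrier R" and unit: "\<rho> A \<in> Units R"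
    and seg: "\<And>D. D \<in> T \<Longrightarrow> \<exists>\<tau>\<ge>0. \<tau> \<le> 1 \<and> (\<forall>i. real (D $ i) = real (A $ i) + \<tau> * (real (B $ i) - real (A $ i)))"
    and level: "l \<bullet> real_vec B = l \<bullet> real_vec A"
    and K: "ideal K R"
    and dom: "\<And>D. D \<in> W \<Longrightarrow> C \<le> D \<Longrightarrow> monomial R x D \<in> K"
    and ndom: "\<And>D. D \<in> W \<Longrightarrow> A - C \<le> D \<Longrightarrow> G \<otimes> monomial R x (D - (A - C)) \<in> K"
    and D: "D \<in> W"
  shows "monomial R x D \<in> K"
  using D
\<comment> \<open>The measure is the total deficit of \<open>D\<close> against \<open>A\<close> in
  the coordinates that increase along the edge. Only in these can \<open>D\<close> fail to dominate
  \<open>C\<close>.\<close>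
proof (induction "\<Sum>i\<in>UNIV. if A $ i < B $ i then A $ i - D $ i else 0" arbitrary: D rule: less_induct)
  case less
  show ?case
  proof (cases "C \<le> D")
    case True
    with less.prems dom show ?thesis by blast
  next
    case False
    then obtain i where i: "D $ i < C $ i" by (auto simp: less_eq_vec_def not_le)
    obtain s where s: "s \<le> 1" "\<And>j. real (A $ j) + s * (real (B $ j) - real (A $ j)) \<le> real (D $ j)"
      and lD: "l \<bullet> real_vec A + t \<le> l \<bullet> real_vec D"
      using less.prems by (auto simp: W_def)
    have Ci: "C $ j = min (A $ j) (B $ j)" for j by (simp add: C_def)
    \<comment> \<open>In coordinate \<open>i\<close> the exponent \<open>D\<close> stays below both
      end points. Being below \<open>B\<close> with \<open>s \<le> 1\<close> makes the edge increase
      there, and being below \<open>A\<close> then makes \<open>s\<close> negative.\<close>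
    have "s < 0 \<and> A $ i < B $ i"
    proof -
      have lt: "real (D $ i) < real (A $ i)" "real (D $ i) < real (B $ i)" using i by (auto simp: Ci)
      have neg: "s * (real (B $ i) - real (A $ i)) < 0" using s(2)[of i] lt(1) by linarith
      have "(1 - s) * (real (B $ i) - real (A $ i)) > 0" using s(2)[of i] lt(2) by (simp add: algebra_simps)
      then have "real (B $ i) - real (A $ i) > 0" using s(1) by (simp add: zero_less_mult_iff)
      then show ?thesis using neg by (simp add: mult_less_0_iff)
    qed
    then have s0: "s < 0" and AB: "A $ i < B $ i" by auto
    have AD: "A $ j \<le> D $ j" if "B $ j \<le> A $ j" for j
    proof -
      have "0 \<le> s * (real (B $ j) - real (A $ j))" using s0 that by (simp add: mult_nonpos_nonpos)
      then show ?thesis using s(2)[of j] by linarith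
    qed
    \<comment> \<open>Where the edge does not increase, \<open>D\<close> dominates \<open>A\<close>
      itself; in all other coordinates \<open>A\<close> and \<open>C\<close> agree.\<close>
    have "A $ j - C $ j \<le> D $ j" for j using AD[of j] by (cases "B $ j \<le> A $ j") (auto simp: Ci)
    then have ACD: "A - C \<le> D" by (simp add: less_eq_vec_def)
    define E where "E = D - (A - C)"
    have DE: "D = E + (A - C)" using ACD by (auto simp: E_def vec_eq_iff less_eq_vec_def)
    \<comment> \<open>In \<open>G \<otimes> monomial R x E\<close> the term of \<open>A\<close> is a
      unit times \<open>x^D\<close>. The term of another \<open>D'\<close> has exponent
      \<open>D + \<tau> (B - A)\<close> with \<open>\<tau> > 0\<close>, whose deficit is
      smaller.\<close>
    have step: "monomial R x (E + (D' - C)) \<in> K" if D': "D' \<in> T - {A}" for D'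
    proof -
      obtain \<tau> where \<tau>: "0 \<le> \<tau>" "\<tau> \<le> 1" "\<And>j. real (D' $ j) = real (A $ j) + \<tau> * (real (B $ j) - real (A $ j))"
        using seg[of D'] D' by blast
      have "\<tau> \<noteq> 0" using \<tau>(3) D' by (auto simp: vec_eq_iff)
      then have \<tau>0: "0 < \<tau>" using \<tau>(1) by simp
      have CD': "C $ j \<le> D' $ j" for j
      proof -
        have "real (D' $ j) = (1 - \<tau>) * real (A $ j) + \<tau> * real (B $ j)" using \<tau>(3)[of j] by (simp add: algebra_simps)
        also have "\<dots> \<ge> (1 - \<tau>) * real (C $ j) + \<tau> * real (C $ j)"
          using \<tau>(1,2) by (intro add_mono mult_left_mono) (auto simp: Ci)
        finally show ?thesis by (simp add: algebra_simps)
      qed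
      have ac: "A $ j - C $ j \<le> D $ j" for j using ACD by (simp add: less_eq_vec_def)
      have new: "real ((E + (D' - C)) $ j) = real (D $ j) + \<tau> * (real (B $ j) - real (A $ j))" for j
        using \<tau>(3)[of j] CD'[of j] ac[of j] by (simp add: E_def of_nat_diff Ci)
      show ?thesis
      proof (rule less.hyps)
        have "real_vec (E + (D' - C)) = real_vec D + \<tau> *\<^sub>R (real_vec B - real_vec A)"
          using new by (simp add: vec_eq_iff)
        then have "l \<bullet> real_vec (E + (D' - C)) = l \<bullet> real_vec D"
          using level by (simp only: inner_add_right inner_scaleR_right inner_diff_right) simp
        moreover have "real (A $ j) + (s + \<tau>) * (real (B $ j) - real (A $ j)) \<le> real ((E + (D' - C)) $ j)" for j
          unfolding new using s(2)[of j] by (simp add: algebra_simps)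
        \<comment> \<open>The range of the parameter survives because \<open>s\<close> is negative
          and a step along the edge has length at most 1.\<close>
        moreover have "s + \<tau> \<le> 1" using s0 \<tau>(2) by simp
        ultimately show "E + (D' - C) \<in> W" unfolding W_def using lD by fastforce
        have le: "D $ j \<le> (E + (D' - C)) $ j" if "A $ j < B $ j" for j
        proof -
          have "0 \<le> \<tau> * (real (B $ j) - real (A $ j))" using that \<tau>(1) by simp
          then have "real (D $ j) \<le> real ((E + (D' - C)) $ j)" using new[of j] by linarith
          then show ?thesis by linarith
        qed
        have "0 < \<tau> * (real (B $ i) - real (A $ i))" using AB \<tau>0 by simp
        then have "real (D $ i) < real ((E + (D' - C)) $ i)" using new[of i] by linarith
        then have lt: "D $ i < (E + (D' - C)) $ i" by linarith
        show "(\<Sum>j\<in>UNIV. if A $ j < B $ j then A $ j - (E + (D' - C)) $ j else 0) <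
            (\<Sum>j\<in>UNIV. if A $ j < B $ j then A $ j - D $ j else 0)"
        proof (rule sum_strict_mono_ex1)
          show "\<forall>j\<in>UNIV. (if A $ j < B $ j then A $ j - (E + (D' - C)) $ j else 0) \<le>
              (if A $ j < B $ j then A $ j - D $ j else 0)"
            using le by (auto intro: diff_le_mono2)
          show "\<exists>j\<in>UNIV. (if A $ j < B $ j then A $ j - (E + (D' - C)) $ j else 0) <
              (if A $ j < B $ j then A $ j - D $ j else 0)"
            using lt i AB by (intro bexI[of _ i]) (auto simp: Ci)
        qed simp
      qed
    qed
    define r where "r = (\<Oplus>D'\<in>T - {A}. \<rho> D' \<otimes> monomial R x (D' - C))"
    have rc: "r \<in> carrier R" unfolding r_def using \<rho> by (intro finsum_closed) auto
    have "G = (\<Oplus>D'\<in>insert A (T - {A}). \<rho> D' \<otimes> monomial R x (D' - C))"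
      unfolding G_def using T(2) by (simp add: insert_absorb)
    also have "\<dots> = \<rho> A \<otimes> monomial R x (A - C) \<oplus> r"
      unfolding r_def using T \<rho> by (intro finsum_insert) auto
    finally have G: "G = \<rho> A \<otimes> monomial R x (A - C) \<oplus> r" .
    have "monomial R x E \<otimes> r = (\<Oplus>D'\<in>T - {A}. monomial R x E \<otimes> (\<rho> D' \<otimes> monomial R x (D' - C)))"
      unfolding r_def using T(1) \<rho> by (intro finsum_rdistr) auto
    also have "\<dots> \<in> K"
    proof (rule ideal_finsum_closed[OF K])
      fix D' assume D': "D' \<in> T - {A}"
      have "\<rho> D' \<otimes> monomial R x (E + (D' - C)) \<in> K"
        using ideal.I_l_closed[OF K step[OF D']] \<rho> D' by blast
      moreover have "\<rho> D' \<otimes> monomial R x (E + (D' - C)) = monomial R x E \<otimes> (\<rho> D' \<otimes> monomial R x (D' - C))"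
        unfolding monomial_add using \<rho> D' by (intro m_lcomm) auto
      ultimately show "monomial R x E \<otimes> (\<rho> D' \<otimes> monomial R x (D' - C)) \<in> K" by simp
    qed
    finally have "G \<otimes> monomial R x E \<ominus> monomial R x E \<otimes> r \<in> K"
      using ndom[OF less.prems ACD] unfolding E_def[symmetric] by (intro ideal_minus_closed[OF K])
    moreover have "G \<otimes> monomial R x E \<ominus> monomial R x E \<otimes> r = \<rho> A \<otimes> monomial R x D"
      unfolding G DE monomial_add using rc Units_closed[OF unit] monomial_closed[of E] monomial_closed[of "A - C"]
      by algebra
    ultimately have "inv (\<rho> A) \<otimes> (\<rho> A \<otimes> monomial R x D) \<in> K"
      using ideal.I_l_closed[OF K] unit by auto
    then show ?thesis using unit by (simp add: m_assoc[symmetric] Units_closed)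
  qed
qed

end

section \<open>Loose edges\<close>

lemma support_in_polyhedron: "A \<in> S \<Longrightarrow> real_vec A \<in> polyhedron_of_support S"
proof -
  assume "A \<in> S"
  moreover have "real_vec A = real_vec A + 0" by simp
  ultimately have "real_vec A \<in> {real_vec A + v |A v. A \<in> S \<and> (\<forall>i. 0 \<le> v $ i)}" by fastforce
  then show ?thesis unfolding polyhedron_of_support_def by (rule hull_inc)
qed

lemma finite_attains_min:
  fixes f :: "'a \<Rightarrow> 'b::linorder"
  assumes "finite S" "S \<noteq> {}"
  shows "\<exists>a\<in>S. \<forall>b\<in>S. f a \<le> f b"
  using ex_is_arg_min_if_finite[OF assms, of f] by (auto simp: is_arg_min_linorder)

lemma polyhedron_minimal:
  assumes "closed Q" "convex Q" "\<And>A v. A \<in> S \<Longrightarrow> \<forall>i. 0 \<le> v $ i \<Longrightarrow> real_vec A + v \<in> Q"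
  shows "polyhedron_of_support S \<subseteq> Q"
  unfolding polyhedron_of_support_def using assms by (intro hull_minimal) auto

lemma polyhedron_empty: "polyhedron_of_support {} = {}"
  using polyhedron_minimal[of "{}" "{}"] by auto

lemma inner_nonneg_vec:
  fixes l v :: "real ^ 'n::finite"
  shows "\<forall>i. 0 \<le> l $ i \<Longrightarrow> \<forall>i. 0 \<le> v $ i \<Longrightarrow> 0 \<le> l \<bullet> v"
  by (simp add: inner_vec_def sum_nonneg)

lemma polyhedron_lower_bound:
  assumes "\<forall>i. 0 \<le> l $ i" "\<And>A. A \<in> S \<Longrightarrow> m \<le> l \<bullet> real_vec A" "w \<in> polyhedron_of_support S"
  shows "m \<le> l \<bullet> w"
proof -
  have "polyhedron_of_support S \<subseteq> {w. l \<bullet> w \<ge> m}"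
  proof (rule polyhedron_minimal)
    fix A and v :: "real ^ 'a" assume "A \<in> S" "\<forall>i. 0 \<le> v $ i"
    then have "m \<le> l \<bullet> real_vec A" "0 \<le> l \<bullet> v" using assms(2) inner_nonneg_vec[OF assms(1)] by blast+
    then show "real_vec A + v \<in> {w. l \<bullet> w \<ge> m}" by (simp only: mem_Collect_eq inner_add_right)
  qed (rule closed_halfspace_ge convex_halfspace_ge)+
  then show ?thesis using assms(3) by auto
qed

lemma aff_dim_three:
  fixes a b v :: "'a::euclidean_space"
  assumes "a \<noteq> b" "v \<notin> affine hull {a, b}"
  shows "aff_dim {v, a, b} = 2"
  using assms by (simp add: aff_dim_insert)

text \<open>The polyhedron lies in a cone with apex \<open>A\<close> on which the linear form bounds the distance to \<open>A\<close>.\<close>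

lemma face_single_point:
  fixes S :: "(nat ^ 'n::finite) set"
  assumes S: "finite S" "A \<in> S" and l: "\<forall>i. 0 < l $ i"
    and low: "\<And>D. D \<in> S \<Longrightarrow> D \<noteq> A \<Longrightarrow> l \<bullet> real_vec A < l \<bullet> real_vec D"
    and v: "v \<in> polyhedron_of_support S" "l \<bullet> v \<le> l \<bullet> real_vec A"
  shows "v = real_vec A"
proof -
  define a :: "real ^ 'n" where "a = real_vec A"
  \<comment> \<open>The opening of the cone is the least of finitely many positive slopes of
    \<open>l\<close>: towards the other support points and along the coordinate axes.\<close>
  define slope where "slope D = (l \<bullet> (real_vec D - a)) / norm (real_vec D - a)" for D
  define slopes where "slopes = range (\<lambda>i. l $ i) \<union> slope ` (S - {A})"
  define e where "e = Min slopes"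
  have ne: "real_vec D - a \<noteq> 0" if "D \<noteq> A" for D using that by (auto simp: a_def vec_eq_iff)
  have slopes: "finite slopes" "slopes \<noteq> {}" using S by (auto simp: slopes_def)
  have pos: "\<forall>z\<in>slopes. 0 < z"
  proof
    fix z assume "z \<in> slopes"
    then consider i where "z = l $ i" | D where "D \<in> S" "D \<noteq> A" "z = slope D"
      by (auto simp: slopes_def)
    then show "0 < z"
    proof cases
      case (2 D)
      then have "0 < l \<bullet> (real_vec D - a)" using low[of D] by (simp only: inner_diff_right a_def) simp
      then show ?thesis using 2 ne[of D] by (simp add: slope_def)
    qed (use l in auto)
  qed
  then have e: "0 < e" unfolding e_def using slopes by simp
  have el: "e \<le> l $ i" for i unfolding e_def using slopes by (intro Min_le) (auto simp: slopes_def)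
  have eD: "e * norm (real_vec D - a) \<le> l \<bullet> (real_vec D - a)" if "D \<in> S" for D
  proof (cases "D = A")
    case False
    then have "e \<le> slope D"
      unfolding e_def using slopes that by (intro Min_le) (auto simp: slopes_def)
    then show ?thesis using ne[OF False] by (simp add: slope_def pos_le_divide_eq)
  qed (simp add: a_def)
  define Q where "Q = {w. e * norm (w - a) \<le> l \<bullet> (w - a)}"
  have "polyhedron_of_support S \<subseteq> Q"
  proof (rule polyhedron_minimal)
    show "closed Q" unfolding Q_def by (intro closed_Collect_le continuous_intros)
    show "convex Q"
    proof (rule convexI)
      fix y z :: "real ^ 'n" and u w :: real
      assume yz: "y \<in> Q" "z \<in> Q" and u: "0 \<le> u" "0 \<le> w" "u + w = 1"
      have eq: "u *\<^sub>R y + w *\<^sub>R z - a = u *\<^sub>R (y - a) + w *\<^sub>R (z - a)"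
        using u(3) by (simp add: algebra_simps flip: scaleR_add_left)
      have "e * norm (u *\<^sub>R y + w *\<^sub>R z - a) \<le> e * (u * norm (y - a) + w * norm (z - a))"
        unfolding eq using e u norm_triangle_ineq[of "u *\<^sub>R (y - a)" "w *\<^sub>R (z - a)"]
        by (intro mult_left_mono) auto
      also have "\<dots> = u * (e * norm (y - a)) + w * (e * norm (z - a))" by (simp add: algebra_simps)
      also have "\<dots> \<le> u * (l \<bullet> (y - a)) + w * (l \<bullet> (z - a))"
        using yz u by (intro add_mono mult_left_mono) (auto simp: Q_def)
      also have "\<dots> = l \<bullet> (u *\<^sub>R y + w *\<^sub>R z - a)" unfolding eq by (simp add: inner_add_right)
      finally show "u *\<^sub>R y + w *\<^sub>R z \<in> Q" by (simp add: Q_def)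
    qed
    fix D and w :: "real ^ 'n" assume D: "D \<in> S" and w: "\<forall>i. 0 \<le> w $ i"
    \<comment> \<open>For the orthant part, the Euclidean norm is at most the sum of the nonnegative
      coordinates, and \<open>e\<close> is at most every \<open>l $ i\<close>.\<close>
    have "e * norm w \<le> e * (\<Sum>i\<in>UNIV. w $ i)"
      using norm_le_l1_cart[of w] w e by (intro mult_left_mono) auto
    also have "\<dots> = (\<Sum>i\<in>UNIV. e * w $ i)" by (simp add: sum_distrib_left)
    also have "\<dots> \<le> (\<Sum>i\<in>UNIV. l $ i * w $ i)" using el w by (intro sum_mono mult_right_mono) auto
    also have "\<dots> = l \<bullet> w" by (simp add: inner_vec_def)
    finally have "e * norm w \<le> l \<bullet> w" .
    moreover have "e * norm (real_vec D + w - a) \<le> e * (norm (real_vec D - a) + norm w)"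
      using e norm_triangle_ineq[of "real_vec D - a" w] by (intro mult_left_mono) (auto simp: algebra_simps)
    moreover have "l \<bullet> (real_vec D + w - a) = l \<bullet> (real_vec D - a) + l \<bullet> w"
      by (simp add: inner_diff_right inner_add_right)
    ultimately show "real_vec D + w \<in> Q" using eD[OF D] by (simp add: Q_def distrib_left)
  qed
  then have "e * norm (v - a) \<le> l \<bullet> (v - a)" using v(1) by (auto simp: Q_def)
  also have "\<dots> \<le> 0" using v(2) by (simp add: inner_diff_right a_def)
  finally show ?thesis using e by (simp add: a_def mult_le_0_iff)
qed

text \<open>One-dimensional Helly: each condition on \<open>s\<close> is a half-line, or does not
  depend on \<open>s\<close>, so a conflict already occurs among at most two of them. The form is
  supported on the two coordinates concerned.\<close>

lemma separating_form:
  fixes d y :: "real ^ 'n::finite"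
  assumes no: "\<nexists>s. \<forall>i. s * d $ i \<le> y $ i" and pos: "0 < d $ k"
  shows "\<exists>l. (\<forall>i. 0 \<le> l $ i) \<and> l \<bullet> d = 0 \<and> l \<bullet> y < 0"
proof -
  have fin: "finite {y $ i / d $ i |i. 0 < d $ i}" by simp
  \<comment> \<open>The largest parameter allowed by the coordinates in which \<open>d\<close> is
    positive; the violated coordinate \<open>j\<close> excludes this value and all smaller
    ones.\<close>
  define s where "s = Min {y $ i / d $ i |i. 0 < d $ i}"
  have "s \<in> {y $ i / d $ i |i. 0 < d $ i}" unfolding s_def using fin pos by (intro Min_in) auto
  then obtain i where i: "s = y $ i / d $ i" "0 < d $ i" by blast
  obtain j where j: "y $ j < s * d $ j" using no by (auto simp: not_le)
  have "\<not> 0 < d $ j"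
  proof
    assume dj: "0 < d $ j"
    then have "s \<le> y $ j / d $ j" unfolding s_def using fin by (intro Min_le) auto
    then show False using j dj by (simp add: pos_le_divide_eq)
  qed
  then have dj: "d $ j \<le> 0" by simp
  let ?l = "axis i (- d $ j) + axis j (d $ i)"
  have "?l \<bullet> y = - d $ j * y $ i + d $ i * y $ j" by (simp add: inner_add_left inner_axis')
  also have "y $ i = s * d $ i" using i by simp
  also have "- d $ j * (s * d $ i) + d $ i * y $ j = d $ i * (y $ j - s * d $ j)" by (simp add: algebra_simps)
  also have "\<dots> < 0" using i(2) j by (simp add: mult_less_0_iff)
  finally have "?l \<bullet> y < 0" .
  moreover have "?l \<bullet> d = 0" by (simp add: inner_add_left inner_axis')
  moreover have "\<forall>k. 0 \<le> ?l $ k" using dj i(2) by (simp add: axis_def)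
  ultimately show ?thesis by blast
qed

text \<open>If some point of the support were not above the line of a loose edge, one could tilt the
  linear form defining the edge until it attains its minimum also at a point off that line.\<close>

lemma loose_edge_support:
  fixes S :: "(nat ^ 'n::finite) set"
  assumes S: "finite S" and loose: "loose_edge (polyhedron_of_support S) E"
  obtains l A B where "\<forall>i. 0 < l $ i" "A \<in> S" "B \<in> S" "A \<noteq> B" "l \<bullet> real_vec B = l \<bullet> real_vec A"
    "\<And>D. D \<in> S \<Longrightarrow> l \<bullet> real_vec A \<le> l \<bullet> real_vec D"
    "\<And>D. D \<in> S \<Longrightarrow> l \<bullet> real_vec D = l \<bullet> real_vec A \<Longrightarrow>
      \<exists>\<tau>\<ge>0. \<tau> \<le> 1 \<and> (\<forall>i. real (D $ i) = real (A $ i) + \<tau> * (real (B $ i) - real (A $ i)))"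
    "\<And>D. D \<in> S \<Longrightarrow> \<exists>s. \<forall>i. real (A $ i) + s * (real (B $ i) - real (A $ i)) \<le> real (D $ i)"
proof -
  let ?P = "polyhedron_of_support S"
  have dim: "aff_dim E = 1" and noface: "\<And>F. compact_face ?P F \<Longrightarrow> aff_dim F \<ge> 2 \<Longrightarrow> \<not> E \<subseteq> F"
    using loose by (auto simp: loose_edge_def np_edge_def)
  obtain l where l: "\<forall>i. 0 < l $ i" and E: "E = {v \<in> ?P. \<forall>w\<in>?P. l \<bullet> v \<le> l \<bullet> w}"
    using loose by (auto simp: loose_edge_def np_edge_def compact_face_def)
  have l0: "\<forall>i. 0 \<le> l $ i" using l by (auto intro: less_imp_le)
  have "E \<noteq> {}" using dim by auto
  then have "S \<noteq> {}" unfolding E using polyhedron_empty by auto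
  then obtain A0 where A0: "A0 \<in> S" "\<And>D. D \<in> S \<Longrightarrow> l \<bullet> real_vec A0 \<le> l \<bullet> real_vec D"
    using finite_attains_min[OF S, of "\<lambda>D. l \<bullet> real_vec D"] by blast
  define m where "m = l \<bullet> real_vec A0"
  define T where "T = {D \<in> S. l \<bullet> real_vec D = m}"
  have low: "m \<le> l \<bullet> w" if "w \<in> ?P" for w
    unfolding m_def using polyhedron_lower_bound[OF l0 A0(2) that] by blast
  have Eeq: "v \<in> E \<longleftrightarrow> v \<in> ?P \<and> l \<bullet> v = m" for v
  proof
    assume "v \<in> E"
    then have "v \<in> ?P" "l \<bullet> v \<le> m"
      using support_in_polyhedron[OF A0(1)] unfolding E m_def by blast+
    then show "v \<in> ?P \<and> l \<bullet> v = m" using low[of v] by simp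
  qed (use low E in simp)
  have TE: "real_vec D \<in> E" if "D \<in> T" for D
    using that support_in_polyhedron by (auto simp: Eeq T_def)
  have fT: "finite T" and A0T: "A0 \<in> T" using S A0 by (auto simp: T_def m_def)
  \<comment> \<open>With a single minimizing support point the face would be that point alone,
    contrary to its dimension 1.\<close>
  have "\<exists>D\<in>T. D \<noteq> A0"
  proof (rule ccontr)
    assume neg: "\<not> ?thesis"
    have "E \<subseteq> {real_vec A0}"
    proof
      fix v assume "v \<in> E"
      then have "v = real_vec A0"
        using neg A0 by (intro face_single_point[OF S A0(1) l]) (force simp: Eeq T_def m_def less_le)+
      then show "v \<in> {real_vec A0}" by simp
    qed
    then have "aff_dim E \<le> aff_dim {real_vec A0}" by (rule aff_dim_subset)
    then show False using dim by simp
  qed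
  then obtain D1 k where D1: "D1 \<in> T" "D1 $ k \<noteq> A0 $ k" by (auto simp: vec_eq_iff)
  \<comment> \<open>A coordinate that is not constant on a line parametrizes it, so the extremes of
    coordinate \<open>k\<close> on \<open>T\<close> are the end points of the edge.\<close>
  obtain A where A: "A \<in> T" "\<And>D. D \<in> T \<Longrightarrow> A $ k \<le> D $ k"
    using finite_attains_min[OF fT, of "\<lambda>D. D $ k"] A0T by blast
  have "\<exists>B\<in>T. \<forall>D\<in>T. D $ k \<le> B $ k"
  proof -
    have "Max ((\<lambda>D. D $ k) ` T) \<in> (\<lambda>D. D $ k) ` T" using fT A0T by (intro Max_in) auto
    then obtain B where B: "B \<in> T" "Max ((\<lambda>D. D $ k) ` T) = B $ k" by auto
    then have "D $ k \<le> B $ k" if "D \<in> T" for D using fT that by (metis Max_ge finite_imageI imageI)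
    then show ?thesis using B(1) by blast
  qed
  then obtain B where B: "B \<in> T" "\<And>D. D \<in> T \<Longrightarrow> D $ k \<le> B $ k" by blast
  have AB: "A $ k < B $ k"
    using D1(2) A(2)[OF D1(1)] A(2)[OF A0T] B(2)[OF D1(1)] B(2)[OF A0T] by linarith
  define a b d where "a = real_vec A" and "b = real_vec B" and "d = b - a"
  have dk: "0 < d $ k" using AB by (simp add: d_def a_def b_def)
  then have ab: "a \<noteq> b" by (auto simp: d_def)
  have hull: "affine hull {a, b} = range (\<lambda>u. a + u *\<^sub>R d)" by (simp add: affine_hull_2_alt d_def)
  have aE: "a \<in> E" "b \<in> E" using TE A(1) B(1) by (auto simp: a_def b_def)
  have Ehull: "\<exists>u. v = a + u *\<^sub>R d" if "v \<in> E" for v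
  proof (rule ccontr)
    assume "\<not> ?thesis"
    then have "aff_dim {v, a, b} = 2" using ab by (intro aff_dim_three) (auto simp: hull)
    moreover have "aff_dim {v, a, b} \<le> aff_dim E" using that aE by (intro aff_dim_subset) auto
    ultimately show False using dim by simp
  qed
  have la: "l \<bullet> a = m" "l \<bullet> b = m" using aE by (auto simp: Eeq)
  have ld: "l \<bullet> d = 0" by (simp add: d_def inner_diff_right la)
  have seg: "\<exists>\<tau>\<ge>0. \<tau> \<le> 1 \<and> (\<forall>i. real (D $ i) = real (A $ i) + \<tau> * (real (B $ i) - real (A $ i)))"
    if D: "D \<in> T" for D
  proof -
    obtain \<tau> where \<tau>: "real_vec D = a + \<tau> *\<^sub>R d" using Ehull[OF TE[OF D]] by blast
    have eq: "real (D $ i) = real (A $ i) + \<tau> * (real (B $ i) - real (A $ i))" for i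
      using arg_cong[OF \<tau>, of "\<lambda>v. v $ i"] by (simp add: a_def b_def d_def)
    have "real (A $ k) \<le> real (D $ k)" "real (D $ k) \<le> real (B $ k)" using A(2)[OF D] B(2)[OF D] by auto
    then have "0 \<le> \<tau> * d $ k" "0 \<le> (1 - \<tau>) * d $ k"
      unfolding eq[of k] by (auto simp: d_def a_def b_def algebra_simps)
    then have "0 \<le> \<tau>" "\<tau> \<le> 1" using dk by (auto simp: zero_le_mult_iff)
    then show ?thesis using eq by blast
  qed
  have above: "\<exists>s. \<forall>i. s * d $ i \<le> (real_vec D0 - a) $ i" if D0: "D0 \<in> S" for D0
  proof (rule ccontr)
    assume "\<not> ?thesis"
    then obtain l' where l': "\<forall>i. 0 \<le> l' $ i" "l' \<bullet> d = 0" "l' \<bullet> (real_vec D0 - a) < 0"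
      using separating_form[OF _ dk] by blast
    define N where "N = {D \<in> S. l' \<bullet> (real_vec D - a) < 0}"
    \<comment> \<open>The multiple of \<open>l'\<close> that has to be added to \<open>l\<close> to
      bring \<open>D\<close> down to the level of the edge. The least ratio belongs to the first
      point reached, so no support point falls below that level.\<close>
    define ratio where "ratio D = (l \<bullet> (real_vec D - a)) / - (l' \<bullet> (real_vec D - a))" for D
    have "finite N" "N \<noteq> {}" using S D0 l'(3) by (auto simp: N_def)
    then obtain D1 where D1: "D1 \<in> N" "\<And>D. D \<in> N \<Longrightarrow> ratio D1 \<le> ratio D"
      using finite_attains_min[of N ratio] by blast
    have lS: "0 \<le> l \<bullet> (real_vec D - a)" if "D \<in> S" for D
      using low[OF support_in_polyhedron[OF that]] la(1) by (simp add: inner_diff_right)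
    have r0: "0 \<le> ratio D1" using D1(1) lS by (auto simp: ratio_def N_def intro!: divide_nonneg_neg)
    define l1 where "l1 = l + ratio D1 *\<^sub>R l'"
    have l1v: "l1 \<bullet> v = l \<bullet> v + ratio D1 * (l' \<bullet> v)" for v by (simp add: l1_def inner_add_left)
    have l1: "\<forall>i. 0 < l1 $ i" using l l'(1) r0 by (simp add: l1_def add_pos_nonneg)
    have D1z: "l1 \<bullet> (real_vec D1 - a) = 0" using D1(1) by (simp add: l1v N_def ratio_def)
    have l1S: "0 \<le> l1 \<bullet> (real_vec D - a)" if D: "D \<in> S" for D
    proof (cases "D \<in> N")
      case True
      then have "0 < - (l' \<bullet> (real_vec D - a))" by (simp add: N_def)
      then have "ratio D1 * - (l' \<bullet> (real_vec D - a)) \<le> l \<bullet> (real_vec D - a)"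
        using D1(2)[OF True] unfolding ratio_def[of D] by (simp only: pos_le_divide_eq)
      then show ?thesis by (simp add: l1v)
    next
      case False
      then show ?thesis using D lS[OF D] r0 by (simp add: l1v N_def)
    qed
    define F where "F = {v \<in> ?P. \<forall>w\<in>?P. l1 \<bullet> v \<le> l1 \<bullet> w}"
    have low1: "l1 \<bullet> a \<le> l1 \<bullet> w" if "w \<in> ?P" for w
    proof (rule polyhedron_lower_bound[OF _ _ that])
      show "\<forall>i. 0 \<le> l1 $ i" using l1 by (auto intro: less_imp_le)
      show "l1 \<bullet> a \<le> l1 \<bullet> real_vec D" if "D \<in> S" for D using l1S[OF that] by (simp add: inner_diff_right)
    qed
    have inF: "v \<in> F" if "v \<in> ?P" "l1 \<bullet> v = l1 \<bullet> a" for v using that low1 by (auto simp: F_def)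
    have EF: "E \<subseteq> F"
    proof
      fix v assume v: "v \<in> E"
      then obtain u where "v = a + u *\<^sub>R d" using Ehull by blast
      then have "l1 \<bullet> v = l1 \<bullet> a" using ld l'(2) by (simp add: l1v inner_add_right)
      then show "v \<in> F" using v by (intro inF) (simp_all add: Eeq)
    qed
    have D1F: "real_vec D1 \<in> F"
      using D1(1) D1z by (intro inF support_in_polyhedron) (auto simp: N_def inner_diff_right)
    have "real_vec D1 \<notin> affine hull {a, b}"
    proof
      assume "real_vec D1 \<in> affine hull {a, b}"
      then obtain u where "real_vec D1 = a + u *\<^sub>R d" by (auto simp: hull)
      then have "l' \<bullet> (real_vec D1 - a) = 0" using l'(2) by simp
      then show False using D1(1) by (simp add: N_def)
    qed
    then have "aff_dim {real_vec D1, a, b} = 2" using ab by (intro aff_dim_three)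
    moreover have "aff_dim {real_vec D1, a, b} \<le> aff_dim F"
      using D1F EF aE by (intro aff_dim_subset) auto
    moreover have "compact_face ?P F" using l1 by (auto simp: compact_face_def F_def)
    ultimately show False using noface EF by auto
  qed
  show thesis
  proof (rule that[OF l])
    show "A \<in> S" "B \<in> S" using A(1) B(1) by (auto simp: T_def)
    show "A \<noteq> B" using AB by auto
    show "l \<bullet> real_vec B = l \<bullet> real_vec A" using la by (simp add: a_def b_def)
    show "l \<bullet> real_vec A \<le> l \<bullet> real_vec D" if "D \<in> S" for D
      using low[OF support_in_polyhedron[OF that]] la by (simp add: a_def)
    show "\<exists>\<tau>\<ge>0. \<tau> \<le> 1 \<and> (\<forall>i. real (D $ i) = real (A $ i) + \<tau> * (real (B $ i) - real (A $ i)))"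
      if "D \<in> S" "l \<bullet> real_vec D = l \<bullet> real_vec A" for D
      using that la by (intro seg) (simp add: T_def a_def)
    show "\<exists>s. \<forall>i. real (A $ i) + s * (real (B $ i) - real (A $ i)) \<le> real (D $ i)" if D: "D \<in> S" for D
    proof -
      obtain s where "\<forall>i. s * d $ i \<le> (real_vec D - a) $ i" using above[OF D] by blast
      then have "real (A $ i) + s * (real (B $ i) - real (A $ i)) \<le> real (D $ i)" for i
        by (auto simp: a_def b_def d_def dest!: spec[of _ i])
      then show ?thesis by blast
    qed
  qed
qed

text \<open>If no coordinate is positive at both \<open>A\<close> and \<open>B\<close>, a point of
  the support above the line dominates a point of the segment. A positive form then attains its
  minimum over the polyhedron at \<open>A\<close> or at \<open>B\<close>, and a vertex consists of a
  single point.\<close>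

lemma at_most_two_vertices:
  fixes A B :: "nat ^ 'n::finite"
  assumes AB: "A \<in> S" "B \<in> S" and disjoint: "\<And>i. min (A $ i) (B $ i) = 0"
    and above: "\<And>D. D \<in> S \<Longrightarrow> \<exists>s. \<forall>i. real (A $ i) + s * (real (B $ i) - real (A $ i)) \<le> real (D $ i)"
    and F: "np_vertex (polyhedron_of_support S) F"
  shows "F \<in> {{real_vec A}, {real_vec B}}"
proof -
  let ?P = "polyhedron_of_support S"
  obtain l where l: "\<forall>i. 0 < l $ i" and Feq: "F = {v \<in> ?P. \<forall>w\<in>?P. l \<bullet> v \<le> l \<bullet> w}"
    and dim: "aff_dim F = 0" using F by (auto simp: np_vertex_def compact_face_def)
  have l0: "\<forall>i. 0 \<le> l $ i" using l by (auto intro: less_imp_le)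
  define m where "m = min (l \<bullet> real_vec A) (l \<bullet> real_vec B)"
  have "m \<le> l \<bullet> real_vec D" if D: "D \<in> S" for D
  proof -
    obtain s where s: "\<And>i. real (A $ i) + s * (real (B $ i) - real (A $ i)) \<le> real (D $ i)"
      using above[OF D] by blast
    \<comment> \<open>The parameter is moved back into the segment. For \<open>s < 0\<close>,
      wherever \<open>A\<close> is nonzero \<open>B\<close> vanishes, so the point of the line lies
      above \<open>A\<close> there; beyond \<open>B\<close> the situation is symmetric.\<close>
    define u where "u = max 0 (min 1 s)"
    have u: "0 \<le> u" "u \<le> 1" by (auto simp: u_def)
    have le: "(1 - u) * real (A $ i) + u * real (B $ i) \<le> real (D $ i)" for i
    proof -
      consider "0 \<le> s \<and> s \<le> 1" | "s < 0" | "1 < s" by linarith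
      then show ?thesis
      proof cases
        case 1
        then show ?thesis using s[of i] by (simp add: u_def algebra_simps)
      next
        case 2
        then have "u = 0" by (simp add: u_def)
        moreover have "real (A $ i) \<le> real (D $ i)"
        proof (cases "A $ i = 0")
          case False
          then have "B $ i = 0" using disjoint[of i] by (auto simp: min_def split: if_splits)
          moreover have "s * real (A $ i) \<le> 0" using 2 by (simp add: mult_nonpos_nonneg)
          ultimately show ?thesis using s[of i] by simp
        qed simp
        ultimately show ?thesis by simp
      next
        case 3
        then have "u = 1" by (simp add: u_def)
        moreover have "real (B $ i) \<le> real (D $ i)"
        proof (cases "B $ i = 0")
          case False
          then have "A $ i = 0" using disjoint[of i] by (auto simp: min_def split: if_splits)
          moreover have "1 * real (B $ i) \<le> s * real (B $ i)" using 3 by (intro mult_right_mono) auto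
          ultimately show ?thesis using s[of i] by simp
        qed simp
        ultimately show ?thesis by simp
      qed
    qed
    have "m = (1 - u) * m + u * m" by (simp add: algebra_simps)
    also have "\<dots> \<le> (1 - u) * (l \<bullet> real_vec A) + u * (l \<bullet> real_vec B)"
      using u by (intro add_mono mult_left_mono) (auto simp: m_def)
    also have "\<dots> = l \<bullet> ((1 - u) *\<^sub>R real_vec A + u *\<^sub>R real_vec B)" by (simp add: inner_add_right)
    also have "\<dots> \<le> l \<bullet> real_vec D"
      using inner_nonneg_vec[OF l0, of "real_vec D - ((1 - u) *\<^sub>R real_vec A + u *\<^sub>R real_vec B)"] le
      by (simp add: inner_diff_right)
    finally show ?thesis .
  qed
  then have low: "m \<le> l \<bullet> w" if "w \<in> ?P" for w using polyhedron_lower_bound[OF l0 _ that] by blast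
  obtain v where v: "F = {v}" using dim by (auto simp: aff_dim_eq_0)
  have "real_vec A \<in> F \<or> real_vec B \<in> F"
    using low support_in_polyhedron[OF AB(1)] support_in_polyhedron[OF AB(2)]
    unfolding Feq m_def by (cases "l \<bullet> real_vec A \<le> l \<bullet> real_vec B") (auto simp: min_def)
  then show ?thesis using v by auto
qed

section \<open>Loose edges with a common monomial factor\<close>

lemma real_vec_diff: "B \<le> A \<Longrightarrow> real_vec (A - B) = real_vec A - real_vec B"
  by (simp add: vec_eq_iff less_eq_vec_def of_nat_diff)

lemma above_line_diff:
  assumes "D \<in> above_line l d a t" "C \<le> a" "C \<le> D"
  shows "D - C \<in> above_line l d (a - C) t"
proof -
  obtain s where s: "\<And>i. real (a $ i) + s * d $ i \<le> real (D $ i)"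
    using assms(1) by (auto simp: above_line_def)
  have "real ((a - C) $ i) + s * d $ i \<le> real ((D - C) $ i)" for i
    using s[of i] assms(2,3) by (simp add: less_eq_vec_def of_nat_diff)
  moreover have "l \<bullet> real_vec (a - C) + t \<le> l \<bullet> real_vec (D - C)"
    unfolding real_vec_diff[OF assms(2)] real_vec_diff[OF assms(3)] inner_diff_right
    using assms(1) by (auto simp: above_line_def)
  ultimately show ?thesis unfolding above_line_def by blast
qed

lemma inner_real_vec_less:
  assumes "\<forall>i. 0 < l $ i" "C \<le> A" "C \<noteq> A"
  shows "l \<bullet> real_vec C < l \<bullet> real_vec A"
proof -
  obtain i where "C $ i \<noteq> A $ i" using assms(3) by (auto simp: vec_eq_iff)
  then have "C $ i < A $ i" using assms(2) by (simp add: less_eq_vec_def less_le)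
  then show ?thesis
    using assms(1,2) unfolding inner_vec_def
    by (intro sum_strict_mono_ex1) (auto simp: less_eq_vec_def less_imp_le)
qed

lemma inner_real_vec_le_total_degree:
  assumes "\<forall>i. 0 < l $ i"
  shows "l \<bullet> real_vec D \<le> (\<Sum>i\<in>UNIV. l $ i) * real (total_degree D)"
proof -
  have "l $ i \<le> (\<Sum>i\<in>UNIV. l $ i)" for i
    using assms by (intro member_le_sum) (auto simp: less_imp_le)
  then have "l \<bullet> real_vec D \<le> (\<Sum>i\<in>UNIV. (\<Sum>i\<in>UNIV. l $ i) * real (D $ i))"
    unfolding inner_vec_def by (intro sum_mono) (auto intro: mult_right_mono)
  then show ?thesis by (simp add: sum_distrib_left)
qed

context cring_with_sequence
begin

text \<open>A monomial that dominates \<open>C\<close> is divisible by \<open>x^C\<close>; any other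
  one is divided by \<open>G\<close>, with the term at one end point as leading term. The level
  \<open>t\<close> is kept because each division shifts the base point along with the
  exponent.\<close>

lemma edge_ideal_decomposition:
  fixes A B :: "nat ^ 'n" and T \<rho> l t
  defines "C \<equiv> \<chi> i. min (A $ i) (B $ i)"
  defines "G \<equiv> \<Oplus>D\<in>T. \<rho> D \<otimes> monomial R x (D - C)"
  defines "d \<equiv> real_vec B - real_vec A"
  assumes T: "finite T" "A \<in> T" "B \<in> T" and \<rho>: "\<And>D. D \<in> T \<Longrightarrow> \<rho> D \<in> carrier R"
    and unit: "\<rho> A \<in> Units R" "\<rho> B \<in> Units R"
    and seg: "\<And>D. D \<in> T \<Longrightarrow> \<exists>\<tau>\<ge>0. \<tau> \<le> 1 \<and> (\<forall>i. real (D $ i) = real (A $ i) + \<tau> * (real (B $ i) - real (A $ i)))"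
    and level: "l \<bullet> real_vec B = l \<bullet> real_vec A"
    and a: "a \<in> mon_ideal (above_line l d A t)"
  shows "\<exists>q\<in>mon_ideal (above_line l d C t). \<exists>p\<in>mon_ideal (above_line l d (A - C) t).
    a = monomial R x C \<otimes> p \<oplus> G \<otimes> q"
proof -
  let ?Q = "mon_ideal (above_line l d C t)" and ?P = "mon_ideal (above_line l d (A - C) t)"
  let ?K = "{a. \<exists>q\<in>?Q. \<exists>p\<in>?P. a = monomial R x C \<otimes> p \<oplus> G \<otimes> q}"
  have CA: "C \<le> A" and CB: "C \<le> B" by (simp_all add: C_def less_eq_vec_def)
  have Gc: "G \<in> carrier R" unfolding G_def using \<rho> by (intro finsum_closed) auto
  have K: "ideal ?K R" using Gc by (intro linear_combination_ideal mon_ideal_ideal) auto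
  have P: "monomial R x D \<in> ?K" if "D \<in> above_line l d A t" "C \<le> D" for D
  proof -
    have D: "D = C + (D - C)" using that(2) by (auto simp: vec_eq_iff less_eq_vec_def)
    have "monomial R x D = monomial R x C \<otimes> monomial R x (D - C) \<oplus> G \<otimes> \<zero>"
      using Gc by (subst D) (simp add: monomial_add)
    then show ?thesis
      using monomial_in_mon_ideal[OF above_line_diff[OF that(1) CA that(2)]]
        ideal_zero_closed[OF mon_ideal_ideal] by blast
  qed
  have Q: "G \<otimes> monomial R x (D - (a - C)) \<in> ?K"
    if "D \<in> above_line l d a t" "a - C \<le> D" "C \<le> a" for D a
  proof -
    have "a - C \<le> a" "a - (a - C) = C" using that(3) by (auto simp: vec_eq_iff less_eq_vec_def)
    then have "monomial R x (D - (a - C)) \<in> ?Q"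
      using monomial_in_mon_ideal[OF above_line_diff[OF that(1) _ that(2)]] by simp
    moreover have "G \<otimes> monomial R x (D - (a - C)) =
        monomial R x C \<otimes> \<zero> \<oplus> G \<otimes> monomial R x (D - (a - C))" using Gc by simp
    ultimately show ?thesis using ideal_zero_closed[OF mon_ideal_ideal] by blast
  qed
  have "mon_ideal (above_line l d A t) \<subseteq> ?K"
  proof (rule mon_ideal_subset[OF K])
    fix D assume "D \<in> above_line l d A t"
    then obtain s where s: "\<And>i. real (A $ i) + s * (real (B $ i) - real (A $ i)) \<le> real (D $ i)"
      and lD: "l \<bullet> real_vec A + t \<le> l \<bullet> real_vec D" by (auto simp: above_line_def d_def)
    show "monomial R x D \<in> ?K"
    proof (cases "s \<le> 1")
      case True
      define W where "W = {D. (\<exists>s\<le>1. \<forall>i. real (A $ i) + s * (real (B $ i) - real (A $ i)) \<le> real (D $ i)) \<and>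
        l \<bullet> real_vec A + t \<le> l \<bullet> real_vec D}"
      have W: "D \<in> above_line l d A t" if "D \<in> W" for D
        using that by (auto simp: W_def above_line_def d_def)
      show ?thesis
      proof (rule edge_division[where A = A and B = B and T = T and \<rho> = \<rho> and l = l and t = t and K = ?K,
            OF T(1,2) \<rho> unit(1) seg level K, folded C_def, folded G_def W_def])
        show "D \<in> W" using True s lD by (auto simp: W_def)
      qed (use P Q[OF _ _ CA] W in blast)+
    next
      case False
      \<comment> \<open>Seen from \<open>B\<close> in the reversed direction, a parameter
        \<open>s > 1\<close> becomes \<open>1 - s\<close>, so the same division applies with the end
        points exchanged; \<open>C\<close> is symmetric in them.\<close>
      have C': "C = (\<chi> i. min (B $ i) (A $ i))" by (simp add: C_def min.commute)
      define W where "W = {D. (\<exists>s\<le>1. \<forall>i. real (B $ i) + s * (real (A $ i) - real (B $ i)) \<le> real (D $ i)) \<and>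
        l \<bullet> real_vec B + t \<le> l \<bullet> real_vec D}"
      have W: "D \<in> above_line l d A t" "D \<in> above_line l d B t" if D: "D \<in> W" for D
      proof -
        obtain s where "\<And>i. real (B $ i) + s * (real (A $ i) - real (B $ i)) \<le> real (D $ i)"
          using D by (auto simp: W_def)
        then have "real (A $ i) + (1 - s) * d $ i \<le> real (D $ i)" "real (B $ i) + (- s) * d $ i \<le> real (D $ i)" for i
          by (simp_all add: d_def algebra_simps)
        then show "D \<in> above_line l d A t" "D \<in> above_line l d B t"
          using D level unfolding above_line_def W_def by fastforce+
      qed
      have seg': "\<exists>\<tau>\<ge>0. \<tau> \<le> 1 \<and> (\<forall>i. real (D $ i) = real (B $ i) + \<tau> * (real (A $ i) - real (B $ i)))"
        if "D \<in> T" for D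
      proof -
        from seg[OF that] obtain \<tau> where
          "\<tau> \<ge> 0" "\<tau> \<le> 1" "\<forall>i. real (D $ i) = real (A $ i) + \<tau> * (real (B $ i) - real (A $ i))"
          by blast
        then show ?thesis by (intro exI[of _ "1 - \<tau>"]) (auto simp: algebra_simps)
      qed
      show ?thesis
      proof (rule edge_division[where A = B and B = A and T = T and \<rho> = \<rho> and l = l and t = t and K = ?K,
            OF T(1,3) \<rho> unit(2) seg' level[symmetric] K, folded C', folded G_def W_def])
        have "real (B $ i) + (1 - s) * (real (A $ i) - real (B $ i)) \<le> real (D $ i)" for i
          using s[of i] by (simp add: algebra_simps)
        moreover have "1 - s \<le> 1" using False by simp
        ultimately show "D \<in> W" using lD level unfolding W_def by fastforce
      qed (use P Q[OF _ _ CB] W in blast)+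
    qed
  qed
  then show ?thesis using a by blast
qed

end

section \<open>From the weight filtration to powers of the maximal ideal\<close>

context local_ring_with_generators
begin

lemma above_line_ideal_in_max:
  assumes l: "\<forall>i. 0 < l $ i" and t: "0 < t"
  shows "mon_ideal (above_line l d a t) \<subseteq> \<mm>"
proof (rule mon_ideal_subset[OF ideal_max])
  fix D assume D: "D \<in> above_line l d a t"
  have "0 \<le> l \<bullet> real_vec a" using l by (intro inner_nonneg_vec) (auto intro: less_imp_le)
  then have "0 < l \<bullet> real_vec D" using D t by (auto simp: above_line_def)
  then have "D \<noteq> 0" by (auto simp: inner_vec_def)
  then show "monomial R x D \<in> \<mm>" by (rule monomial_in_max)
qed

text \<open>The weight of a monomial is at most its degree times the sum of the
  \<open>l $ i\<close>, so large weight forces large degree.\<close>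

lemma above_line_ideal_in_power:
  assumes l: "\<forall>i. 0 < l $ i" and t: "(\<Sum>i\<in>UNIV. l $ i) * real N \<le> t"
  shows "mon_ideal (above_line l d a t) \<subseteq> ideal_power R \<mm> N"
proof -
  have L: "0 < (\<Sum>i\<in>UNIV. l $ i)" using l by (intro sum_pos) auto
  have "N \<le> total_degree D" if D: "D \<in> above_line l d a t" for D
  proof -
    have "0 \<le> l \<bullet> real_vec a" using l by (intro inner_nonneg_vec) (auto intro: less_imp_le)
    then have "(\<Sum>i\<in>UNIV. l $ i) * real N \<le> (\<Sum>i\<in>UNIV. l $ i) * real (total_degree D)"
      using D t inner_real_vec_le_total_degree[OF l, of D] by (auto simp: above_line_def)
    then have "real N \<le> real (total_degree D)" using L by (simp only: mult_le_cancel_left_pos)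
    then show ?thesis by (simp only: of_nat_le_iff)
  qed
  then have "mon_ideal (above_line l d a t) \<subseteq> mon_ideal {D. N \<le> total_degree D}"
    by (intro mon_ideal_mono) auto
  also have "\<dots> \<subseteq> ideal_power R \<mm> N"
    using mon_ideal_total_degree[OF generate_max[symmetric]] .
  finally show ?thesis .
qed

lemma reducible_of_loose_edge_data:
  fixes A B :: "nat ^ 'n"
  assumes f: "f \<in> carrier R" and exp: "is_expansion R x f \<rho>" and S: "S = {D. \<rho> D \<noteq> \<zero>}"
    and l: "\<forall>i. 0 < l $ i" and AB: "A \<in> S" "B \<in> S" "A \<noteq> B"
    and level: "l \<bullet> real_vec B = l \<bullet> real_vec A"
    and low: "\<And>D. D \<in> S \<Longrightarrow> l \<bullet> real_vec A \<le> l \<bullet> real_vec D"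
    and seg: "\<And>D. D \<in> S \<Longrightarrow> l \<bullet> real_vec D = l \<bullet> real_vec A \<Longrightarrow>
      \<exists>\<tau>\<ge>0. \<tau> \<le> 1 \<and> (\<forall>i. real (D $ i) = real (A $ i) + \<tau> * (real (B $ i) - real (A $ i)))"
    and above: "\<And>D. D \<in> S \<Longrightarrow> \<exists>s. \<forall>i. real (A $ i) + s * (real (B $ i) - real (A $ i)) \<le> real (D $ i)"
    and common: "\<exists>i. min (A $ i) (B $ i) \<noteq> 0"
  shows "\<not> ring_irreducible\<^bsub>adic_completion R \<mm>\<^esub> (to_completion R \<mm> f)"
proof -
  define T where "T = {D \<in> S. l \<bullet> real_vec D = l \<bullet> real_vec A}"
  define C :: "nat ^ 'n" where "C = (\<chi> i. min (A $ i) (B $ i))"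
  define G where "G = (\<Oplus>D\<in>T. \<rho> D \<otimes> monomial R x (D - C))"
  define d where "d = real_vec B - real_vec A"
  have fS: "finite S" and fsum: "f = (\<Oplus>D\<in>S. \<rho> D \<otimes> monomial R x D)"
    and unit: "\<And>D. D \<in> S \<Longrightarrow> \<rho> D \<in> Units R"
    using exp by (auto simp: is_expansion_def S)
  have \<rho>: "\<rho> D \<in> carrier R" if "D \<in> S" for D using unit[OF that] by auto
  have T: "finite T" "A \<in> T" "B \<in> T" "T \<subseteq> S" using fS AB level by (auto simp: T_def)
  have CA: "C \<le> A" and CB: "C \<le> B" by (simp_all add: C_def less_eq_vec_def)
  have Gc: "G \<in> carrier R" unfolding G_def using \<rho> T(4) by (intro finsum_closed) auto
  have CD: "C \<le> D" if "D \<in> T" for D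
  proof -
    have "D \<in> S" "l \<bullet> real_vec D = l \<bullet> real_vec A" using that by (simp_all add: T_def)
    from seg[OF this] obtain \<tau> where
      \<tau>: "\<tau> \<ge> 0" "\<tau> \<le> 1" "\<And>i. real (D $ i) = real (A $ i) + \<tau> * (real (B $ i) - real (A $ i))"
      by blast
    have "C $ i \<le> D $ i" for i
    proof -
      have "real (C $ i) = (1 - \<tau>) * real (C $ i) + \<tau> * real (C $ i)" by (simp add: algebra_simps)
      also have "\<dots> \<le> (1 - \<tau>) * real (A $ i) + \<tau> * real (B $ i)"
        using \<tau>(1,2) by (intro add_mono mult_left_mono) (auto simp: C_def)
      also have "\<dots> = real (D $ i)" using \<tau>(3)[of i] by (simp add: algebra_simps)
      finally show ?thesis by simp
    qed
    then show ?thesis by (simp add: less_eq_vec_def)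
  qed
  \<comment> \<open>The support is finite, so the points off the edge are heavier by a uniform gap,
    which becomes the step of the filtration.\<close>
  have "\<exists>\<delta>>0. \<forall>D\<in>S - T. l \<bullet> real_vec A + \<delta> \<le> l \<bullet> real_vec D"
  proof (cases "S - T = {}")
    case False
    obtain D0 where D0: "D0 \<in> S - T" "\<And>D. D \<in> S - T \<Longrightarrow> l \<bullet> real_vec D0 \<le> l \<bullet> real_vec D"
      using finite_attains_min[OF _ False, of "\<lambda>D. l \<bullet> real_vec D"] fS by blast
    have "l \<bullet> real_vec A < l \<bullet> real_vec D0" using D0(1) low[of D0] by (auto simp: T_def less_le)
    then show ?thesis using D0(2) by (intro exI[of _ "l \<bullet> real_vec D0 - l \<bullet> real_vec A"]) simp
  qed (auto intro: exI[of _ 1])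
  then obtain \<delta> where \<delta>: "0 < \<delta>" "\<And>D. D \<in> S - T \<Longrightarrow> l \<bullet> real_vec A + \<delta> \<le> l \<bullet> real_vec D" by blast
  define I where "I a n = mon_ideal (above_line l d a (real n * \<delta>))" for a n
  have Iideal: "ideal (I a n) R" for a n unfolding I_def by (rule mon_ideal_ideal)
  have Imono: "I a n \<subseteq> I a m" if "m \<le> n" for a m n
    unfolding I_def using that \<delta>(1) by (intro mon_ideal_mono above_line_antimono) simp
  have start: "f \<ominus> monomial R x C \<otimes> G \<in> I A 1"
  proof -
    let ?r = "\<Oplus>D\<in>S - T. \<rho> D \<otimes> monomial R x D"
    have rI: "?r \<in> I A 1"
    proof (rule ideal_finsum_closed[OF Iideal])
      fix D assume D: "D \<in> S - T"
      have "D \<in> above_line l d A (real 1 * \<delta>)"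
        using above[of D] \<delta>(2)[OF D] D by (simp add: above_line_def d_def)
      then have "monomial R x D \<in> I A 1" unfolding I_def by (rule monomial_in_mon_ideal)
      then show "\<rho> D \<otimes> monomial R x D \<in> I A 1" using ideal.I_l_closed[OF Iideal] \<rho> D by blast
    qed
    have rc: "?r \<in> carrier R" using ideal.Icarr[OF Iideal rI] .
    have "monomial R x C \<otimes> G = (\<Oplus>D\<in>T. monomial R x C \<otimes> (\<rho> D \<otimes> monomial R x (D - C)))"
      unfolding G_def using T \<rho> by (intro finsum_rdistr) auto
    also have "\<dots> = (\<Oplus>D\<in>T. \<rho> D \<otimes> monomial R x D)"
    proof (rule finsum_cong')
      fix D assume D: "D \<in> T"
      then have "D = C + (D - C)" using CD[OF D] by (auto simp: vec_eq_iff less_eq_vec_def)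
      then have "monomial R x D = monomial R x C \<otimes> monomial R x (D - C)" by (metis monomial_add)
      then show "monomial R x C \<otimes> (\<rho> D \<otimes> monomial R x (D - C)) = \<rho> D \<otimes> monomial R x D"
        using \<rho>[of D] D T(4) by (simp add: m_lcomm subset_eq)
    qed (use \<rho> T(4) in auto)
    finally have CG: "monomial R x C \<otimes> G = (\<Oplus>D\<in>T. \<rho> D \<otimes> monomial R x D)" .
    have "f = (\<Oplus>D\<in>T \<union> (S - T). \<rho> D \<otimes> monomial R x D)"
      unfolding fsum using T(4) by (simp add: Un_absorb1)
    also have "\<dots> = monomial R x C \<otimes> G \<oplus> ?r"
      unfolding CG using T fS \<rho> by (intro finsum_Un_disjoint) auto
    finally have "f \<ominus> monomial R x C \<otimes> G = (monomial R x C \<otimes> G \<oplus> ?r) \<ominus> monomial R x C \<otimes> G"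
      by simp
    also have "\<dots> = ?r"
      using rc m_closed[OF monomial_closed Gc, of C] by (simp add: a_minus_def a_ac r_neg2)
    finally show ?thesis using rI by simp
  qed
  have decomp: "\<exists>q\<in>I C n. \<exists>p\<in>I (A - C) n. a = monomial R x C \<otimes> p \<oplus> G \<otimes> q" if "a \<in> I A n" for n a
    unfolding I_def C_def G_def d_def
  proof (rule edge_ideal_decomposition[OF T(1-3)])
    show "a \<in> mon_ideal (above_line l (real_vec B - real_vec A) A (real n * \<delta>))"
      using that by (simp add: I_def d_def)
  qed (use \<rho> unit AB level seg T(4) in \<open>auto simp: T_def\<close>)
  have mult: "q \<otimes> p \<in> I A (m + n)" if "q \<in> I C m" "p \<in> I (A - C) n" for m n p q
  proof -
    have "C + (A - C) = A" using CA by (auto simp: vec_eq_iff less_eq_vec_def)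
    then have "D + E \<in> above_line l d A (real (m + n) * \<delta>)"
      if "D \<in> above_line l d C (real m * \<delta>)" "E \<in> above_line l d (A - C) (real n * \<delta>)" for D E
      using above_line_add[OF that] by (simp add: algebra_simps)
    then show ?thesis using that unfolding I_def by (rule mon_ideal_mult[rotated 2])
  qed
  have "\<exists>g h. \<forall>n. g n \<in> carrier R \<and> h n \<in> carrier R \<and>
    g n \<ominus> monomial R x C \<in> I C 1 \<and> h n \<ominus> G \<in> I (A - C) 1 \<and> f \<ominus> g n \<otimes> h n \<in> I A (Suc n) \<and>
    g (Suc n) \<ominus> g n \<in> I C (Suc n) \<and> h (Suc n) \<ominus> h n \<in> I (A - C) (Suc n)"
    by (rule factorization_lifting[OF Iideal Iideal Iideal Imono Imono Imono f monomial_closed Gc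
          start decomp mult])
  then obtain g h where gh: "\<forall>n. g n \<in> carrier R \<and> h n \<in> carrier R \<and>
    g n \<ominus> monomial R x C \<in> I C 1 \<and> h n \<ominus> G \<in> I (A - C) 1 \<and> f \<ominus> g n \<otimes> h n \<in> I A (Suc n) \<and>
    g (Suc n) \<ominus> g n \<in> I C (Suc n) \<and> h (Suc n) \<ominus> h n \<in> I (A - C) (Suc n)"
    by (elim exE)
  have gc: "g n \<in> carrier R" and hc: "h n \<in> carrier R"
    and g0: "g n \<ominus> monomial R x C \<in> I C 1" and h0: "h n \<ominus> G \<in> I (A - C) 1"
    and fgh: "f \<ominus> g n \<otimes> h n \<in> I A (Suc n)"
    and gS: "g (Suc n) \<ominus> g n \<in> I C (Suc n)" and hS: "h (Suc n) \<ominus> h n \<in> I (A - C) (Suc n)" for n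
    using gh[rule_format, of n] by blast+
  have telescope: "u m \<ominus> u n \<in> I a n"
    if "\<And>n. u n \<in> carrier R" "\<And>n. u (Suc n) \<ominus> u n \<in> I a (Suc n)" "n \<le> m" for u a n m
    using that(3)
  proof (induction m rule: dec_induct)
    case base
    then show ?case using that(1) by (simp add: a_minus_def r_neg ideal_zero_closed[OF Iideal])
  next
    case (step m)
    have "u (Suc m) \<ominus> u m \<in> I a n" using that(2)[of m] Imono[of n "Suc m"] step(1) by auto
    then show ?case using step ideal_minus_trans[OF Iideal _ _ that(1) that(1) that(1)] by blast
  qed
  \<comment> \<open>\<open>k\<close> filtration steps raise the weight by at least \<open>L\<close>,
    enough for one more power of \<open>\<mm>\<close>.\<close>
  define L where "L = (\<Sum>i\<in>UNIV. l $ i)"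
  obtain k :: nat where k: "L / \<delta> \<le> real k" using real_arch_simple by blast
  have IP: "I a (n * k) \<subseteq> ideal_power R \<mm> n" for a n
    unfolding I_def
  proof (rule above_line_ideal_in_power[OF l], fold L_def)
    have "L \<le> real k * \<delta>" using k \<delta>(1) by (simp add: pos_divide_le_eq)
    then have "L * real n \<le> (real k * \<delta>) * real n" by (intro mult_right_mono) auto
    then show "L * real n \<le> real (n * k) * \<delta>" by (simp add: algebra_simps)
  qed
  have Imax: "I a 1 \<subseteq> \<mm>" for a
    unfolding I_def using \<delta>(1) by (intro above_line_ideal_in_max[OF l]) simp
  have "C \<noteq> 0" using common by (auto simp: C_def vec_eq_iff)
  then have Cm: "monomial R x C \<in> \<mm>" by (rule monomial_in_max)
  \<comment> \<open>\<open>C\<close> differs from at least one of the end points, and these have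
    equal weight. Hence \<open>C\<close> is lighter than every exponent in \<open>T\<close>, and no
    monomial of \<open>G\<close> is constant.\<close>
  have lC: "l \<bullet> real_vec C < l \<bullet> real_vec A"
    using inner_real_vec_less[OF l CA] inner_real_vec_less[OF l CB] AB(3) level by fastforce
  have Gm: "G \<in> \<mm>"
    unfolding G_def
  proof (rule ideal_finsum_closed[OF ideal_max])
    fix D assume D: "D \<in> T"
    then have "D \<noteq> C" using lC by (auto simp: T_def)
    then have "D - C \<noteq> 0" using CD[OF D] by (auto simp: vec_eq_iff less_eq_vec_def) (metis le_antisym)
    then show "\<rho> D \<otimes> monomial R x (D - C) \<in> \<mm>"
      using ideal.I_l_closed[OF ideal_max monomial_in_max] \<rho> D T(4) by blast
  qed
  have in_max: "u \<in> \<mm>" if "u \<ominus> v \<in> I a 1" "v \<in> \<mm>" "u \<in> carrier R" for u v a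
  proof -
    have "(u \<ominus> v) \<oplus> v \<in> \<mm>" using that(1,2) Imax ideal_a_closed[OF ideal_max] by blast
    moreover have "(u \<ominus> v) \<oplus> v = u" using that(3) max_closed[OF that(2)] by algebra
    ultimately show ?thesis by simp
  qed
  show ?thesis
  proof (rule not_ring_irreducible_completion[OF ideal_max one_notin_max f])
    \<comment> \<open>The lifted sequences are read at the multiples of \<open>k\<close> only;
      \<open>1 * k\<close> is the term at index 1 of the thinned sequence.\<close>
    show "g (1 * k) \<in> \<mm>" using in_max[OF g0 Cm gc] .
    show "h (1 * k) \<in> \<mm>" using in_max[OF h0 Gm hc] .
    fix n
    show "g (n * k) \<in> carrier R" "h (n * k) \<in> carrier R" by (rule gc hc)+
    show "g (Suc n * k) \<ominus> g (n * k) \<in> ideal_power R \<mm> n"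
      using telescope[OF gc gS, of "n * k" "Suc n * k"] IP by auto
    show "h (Suc n * k) \<ominus> h (n * k) \<in> ideal_power R \<mm> n"
      using telescope[OF hc hS, of "n * k" "Suc n * k"] IP by auto
    show "f \<ominus> g (n * k) \<otimes> h (n * k) \<in> ideal_power R \<mm> n"
      using fgh[of "n * k"] Imono[of "n * k" "Suc (n * k)"] IP by fastforce
  qed
qed

end

theorem corollary1p2:
  fixes R :: "('a, 'b) ring_scheme" and \<mm> :: "'a set" and x :: "'n::finite \<Rightarrow> 'a" and f :: 'a
  assumes "regular_system_of_parameters R \<mm> x"
    and "f \<in> carrier R" and "f \<noteq> \<zero>\<^bsub>R\<^esub>"
    and "\<exists>E. loose_edge (newton_polyhedron R x f) E"
    and "\<exists>V. V \<subseteq> {F. np_vertex (newton_polyhedron R x f) F} \<and> card V = 3"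
  shows "\<not> ring_irreducible\<^bsub>adic_completion R \<mm>\<^esub> (to_completion R \<mm> f)"
proof -
  interpret regular_system_of_parameters R \<mm> x by fact
  interpret local_ring_with_generators R \<mm> x
    using params_closed params_generate by unfold_locales auto
  define \<rho> where "\<rho> = (SOME \<rho>. is_expansion R x f \<rho>)"
  define S where "S = {A. \<rho> A \<noteq> \<zero>\<^bsub>R\<^esub>}"
  \<comment> \<open>Existence of an expansion is what gives the choice in
    \<open>newton_polyhedron\<close> its meaning.\<close>
  have exp: "is_expansion R x f \<rho>" unfolding \<rho>_def using exists_expansion[OF assms(2)] by (rule someI_ex)
  have NP: "newton_polyhedron R x f = polyhedron_of_support S"
    by (simp add: newton_polyhedron_def S_def \<rho>_def)
  have fin: "finite S" using exp by (simp add: is_expansion_def S_def)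
  obtain E where E: "loose_edge (polyhedron_of_support S) E" using assms(4) NP by auto
  from fin E show ?thesis
  proof (rule loose_edge_support)
    fix l A B
    assume l: "\<forall>i. 0 < l $ i" and AB: "A \<in> S" "B \<in> S" "A \<noteq> B"
      and edge: "l \<bullet> real_vec B = l \<bullet> real_vec A"
        "\<And>D. D \<in> S \<Longrightarrow> l \<bullet> real_vec A \<le> l \<bullet> real_vec D"
        "\<And>D. D \<in> S \<Longrightarrow> l \<bullet> real_vec D = l \<bullet> real_vec A \<Longrightarrow>
          \<exists>\<tau>\<ge>0. \<tau> \<le> 1 \<and> (\<forall>i. real (D $ i) = real (A $ i) + \<tau> * (real (B $ i) - real (A $ i)))"
        "\<And>D. D \<in> S \<Longrightarrow> \<exists>s. \<forall>i. real (A $ i) + s * (real (B $ i) - real (A $ i)) \<le> real (D $ i)"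
    have common: "\<exists>i. min (A $ i) (B $ i) \<noteq> 0"
    proof (rule ccontr)
      assume "\<not> ?thesis"
      then have disjoint: "\<And>i. min (A $ i) (B $ i) = 0" by blast
      obtain V where V: "V \<subseteq> {F. np_vertex (polyhedron_of_support S) F}" "card V = 3"
        using assms(5) NP by auto
      have "V \<subseteq> {{real_vec A}, {real_vec B}}"
        using V(1) at_most_two_vertices[OF AB(1,2) disjoint edge(4)] by blast
      then have "card V \<le> card {{real_vec A}, {real_vec B}}" by (intro card_mono) auto
      also have "\<dots> \<le> 2" by (simp add: card_insert_if)
      finally show False using V(2) by simp
    qed
    show ?thesis
      by (rule reducible_of_loose_edge_data[OF assms(2) exp S_def l AB edge common])
  qed
qed

end
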